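(* Let $\mathcal{V}$ be a closed monoidal category (not assumed symmetric) and let $\mathcal{S}$ be a category with $\mathcal{V}$-structure. Assume that for every $K\in\operatorname{ob}\mathcal{V}$ and $X\in\operatorname{ob}\mathcal{S}$ a $K$-cylinder of $X$ exists, and fix one, $(K\otimes X,\alpha_{K,X},\{\underline\phi_{K,X,Y}\}_{Y\in\operatorname{ob}\mathcal{S}})$. Then: (1) There exists a unique bifunctor $-\otimes-:\mathcal{V}\times\mathcal{S}\to\mathcal{S}$ such that (a) on objects it maps $(K,X)$ to $K\otimes X$; and (b) for all $K,L\in\operatorname{ob}\mathcal{V}$, $X,Y\in\operatorname{ob}\mathcal{S}$, $u\in\mathcal{V}(K,L)$ and $v\in\mathcal{S}(X,Y)$, one has $$\underline{\mathcal{S}}(X,u\otimes X)\cdot\alpha_{K,X}=\alpha_{L,X}\cdot u:\ K\to\underline{\mathcal{S}}(X,L\otimes X)$$ and $$\underline{\mathcal{S}}(X,K\otimes v)\cdot\alpha_{K,X}=\underline{\mathcal{S}}(v,K\otimes Y)\cdot\alpha_{K,Y}:\ K\to\underline{\mathcal{S}}(X,K\otimes Y).$$ (2) The isomorphism $\underline\phi_{K,X,Y}:\underline{\mathcal{S}}(K\otimes X,Y)\to\underline{\mathcal{V}}(K,\underline{\mathcal{S}}(X,Y))$ is natural in $K$, $X$ and $Y$.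
   Context: Composition of morphisms is written $g\cdot f$. A monoidal category $\mathcal{V}=(\mathcal{V},\otimes,I,a,l,r)$ has structure isomorphisms $a_{X,Y,Z}:(X\otimes Y)\otimes Z\to X\otimes(Y\otimes Z)$, $l_X:I\otimes X\to X$, $r_X:X\otimes I\to X$. It is closed if for every $Y$ the functor $-\otimes Y$ has a right adjoint $\underline{\mathcal{V}}(Y,-)$; the adjunction bijection is $\pi_{X,Y,Z}:\mathcal{V}(X\otimes Y,Z)\to\mathcal{V}(X,\underline{\mathcal{V}}(Y,Z))$, with counit $\epsilon_Z:\underline{\mathcal{V}}(Y,Z)\otimes Y\to Z$; $\underline{\mathcal{V}}(-,-):\mathcal{V}^{\mathrm{op}}\times\mathcal{V}\to\mathcal{V}$ denotes the bifunctor extending the $\underline{\mathcal{V}}(Y,-)$ for which $\pi_{X,Y,Z}$ is also natural in $Y$. A category $\mathcal{S}$ has a $\mathcal{V}$-structure if it is equipped with: a functor $\underline{\mathcal{S}}(-,-):\mathcal{S}^{\mathrm{op}}\times\mathcal{S}\to\mathcal{V}$; for all $X,Y,Z$ a morphism $\underline{\bullet}_{X,Y,Z}:\underline{\mathcal{S}}(Y,Z)\otimes\underline{\mathcal{S}}(X,Y)\to\underline{\mathcal{S}}(X,Z)$ of $\mathcal{V}$; and a natural isomorphism $\varphi:\mathcal{S}(-,-)\to\mathcal{V}(I,\underline{\mathcal{S}}(-,-))$; such that (i) $\underline{\bullet}\cdot(\underline{\bullet}\otimes1)=\underline{\bullet}\cdot(1\otimes\underline{\bullet})\cdot a$ as morphisms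 $(\underline{\mathcal{S}}(Z,W)\otimes\underline{\mathcal{S}}(Y,Z))\otimes\underline{\mathcal{S}}(X,Y)\to\underline{\mathcal{S}}(X,W)$; (ii) for $f\in\mathcal{S}(X,Y)$, $\underline{\mathcal{S}}(f,Z)=\underline{\bullet}\cdot(1\otimes\varphi(f))\cdot r^{-1}:\underline{\mathcal{S}}(Y,Z)\to\underline{\mathcal{S}}(X,Z)$; (iii) for $g\in\mathcal{S}(Y,Z)$, $\underline{\mathcal{S}}(X,g)=\underline{\bullet}\cdot(\varphi(g)\otimes1)\cdot l^{-1}:\underline{\mathcal{S}}(X,Y)\to\underline{\mathcal{S}}(X,Z)$. For $K\in\operatorname{ob}\mathcal{V}$, $X\in\operatorname{ob}\mathcal{S}$, a $K$-cylinder of $X$ is a triple $(K\otimes X,\alpha_{K,X},\{\underline\phi_{K,X,Y}\}_{Y\in\operatorname{ob}\mathcal{S}})$ where $K\otimes X$ is an object of $\mathcal{S}$, $\alpha_{K,X}:K\to\underline{\mathcal{S}}(X,K\otimes X)$ is a morphism of $\mathcal{V}$, and $\underline\phi_{K,X,Y}:\underline{\mathcal{S}}(K\otimes X,Y)\to\underline{\mathcal{V}}(K,\underline{\mathcal{S}}(X,Y))$ is an isomorphism of $\mathcal{V}$ for every $Y$, such that $\epsilon_{\underline{\mathcal{S}}(X,Y)}\cdot(\underline\phi_{K,X,Y}\otimes1)=\underline{\bullet}\cdot(1\otimes\alpha_{K,X})$ as morphisms $\underline{\mathcal{S}}(K\otimes X,Y)\otimes K\to\underline{\mathcal{S}}(X,Y)$.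 For a bifunctor $-\otimes-$, $u\otimes X$ means $u\otimes1_X$ and $K\otimes v$ means $1_K\otimes v$. *)

theory Defs
  imports Main "HOL-Library.FuncSet"
begin

section \<open>Categories and functors\<close>

text \<open>
  A category has a set of objects and a set of arrows with source and target, so that distinct
  hom-sets are disjoint.  All operations are total functions in HOL; their values are
  constrained only on the objects and on the (composable) arrows of the category.
\<close>

record ('o, 'a) precat =
  obj :: "'o set"
  arr :: "'a set"
  src :: "'a \<Rightarrow> 'o"
  tgt :: "'a \<Rightarrow> 'o"
  ide :: "'o \<Rightarrow> 'a" (\<open>\<one>\<index>\<close>)
  cmp :: "'a \<Rightarrow> 'a \<Rightarrow> 'a" (infixl \<open>\<cdot>\<index>\<close> 60)

definition hom :: "('o, 'a, 'x) precat_scheme \<Rightarrow> 'o \<Rightarrow> 'o \<Rightarrow> 'a set" where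
  "hom C X Y = {f \<in> arr C. src C f = X \<and> tgt C f = Y}"

locale category =
  fixes C :: "('o, 'a, 'x) precat_scheme" (structure)
  assumes src_obj: "f \<in> arr C \<Longrightarrow> src C f \<in> obj C"
    and tgt_obj: "f \<in> arr C \<Longrightarrow> tgt C f \<in> obj C"
    and ide_hom: "X \<in> obj C \<Longrightarrow> \<one> X \<in> hom C X X"
    and cmp_hom: "f \<in> hom C X Y \<Longrightarrow> g \<in> hom C Y Z \<Longrightarrow> g \<cdot> f \<in> hom C X Z"
    and cmp_ide_right: "f \<in> hom C X Y \<Longrightarrow> f \<cdot> \<one> X = f"
    and cmp_ide_left: "f \<in> hom C X Y \<Longrightarrow> \<one> Y \<cdot> f = f"
    and cmp_assoc: "f \<in> hom C X Y \<Longrightarrow> g \<in> hom C Y Z \<Longrightarrow> h \<in> hom C Z W \<Longrightarrow>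
      (h \<cdot> g) \<cdot> f = h \<cdot> (g \<cdot> f)"

definition inverse_arrows :: "('o, 'a, 'x) precat_scheme \<Rightarrow> 'a \<Rightarrow> 'a \<Rightarrow> bool" where
  "inverse_arrows C f g \<longleftrightarrow>
     f \<in> arr C \<and> g \<in> hom C (tgt C f) (src C f) \<and>
     g \<cdot>\<^bsub>C\<^esub> f = \<one>\<^bsub>C\<^esub> (src C f) \<and> f \<cdot>\<^bsub>C\<^esub> g = \<one>\<^bsub>C\<^esub> (tgt C f)"

definition isos :: "('o, 'a, 'x) precat_scheme \<Rightarrow> 'o \<Rightarrow> 'o \<Rightarrow> 'a set" where
  "isos C X Y = {f \<in> hom C X Y. \<exists>g. inverse_arrows C f g}"

definition inv_arr :: "('o, 'a, 'x) precat_scheme \<Rightarrow> 'a \<Rightarrow> 'a" where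
  "inv_arr C f = (THE g. inverse_arrows C f g)"

definition op_cat :: "('o, 'a, 'x) precat_scheme \<Rightarrow> ('o, 'a) precat" where
  "op_cat C = \<lparr>obj = obj C, arr = arr C, src = tgt C, tgt = src C, ide = ide C,
     cmp = (\<lambda>g f. f \<cdot>\<^bsub>C\<^esub> g)\<rparr>"

definition prod_cat :: "('o, 'a, 'x) precat_scheme \<Rightarrow> ('p, 'b, 'y) precat_scheme \<Rightarrow>
    ('o \<times> 'p, 'a \<times> 'b) precat" (infixr \<open>\<times>\<^sub>c\<close> 80) where
  "C \<times>\<^sub>c D = \<lparr>obj = obj C \<times> obj D, arr = arr C \<times> arr D,
     src = map_prod (src C) (src D), tgt = map_prod (tgt C) (tgt D),
     ide = map_prod (ide C) (ide D),
     cmp = (\<lambda>(g, k) (f, h). (g \<cdot>\<^bsub>C\<^esub> f, k \<cdot>\<^bsub>D\<^esub> h))\<rparr>"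

record ('o, 'a, 'p, 'b) functor_data =
  fob :: "'o \<Rightarrow> 'p"
  far :: "'a \<Rightarrow> 'b"

text \<open>
  The object and arrow maps of a functor are required to be \<open>undefined\<close> outside the source
  category.  Hence two functors are equal in HOL iff they agree on the objects and
  arrows of the source category, and \<open>\<exists>!\<close> over functors has its usual meaning.
\<close>

locale is_functor = C: category C + D: category D
  for C :: "('o, 'a, 'x) precat_scheme"
    and D :: "('p, 'b, 'y) precat_scheme"
    and F :: "('o, 'a, 'p, 'b) functor_data" +
  assumes fob_ext: "fob F \<in> extensional (obj C)"
    and far_ext: "far F \<in> extensional (arr C)"
    and fob_obj: "X \<in> obj C \<Longrightarrow> fob F X \<in> obj D"
    and far_hom: "f \<in> hom C X Y \<Longrightarrow> far F f \<in> hom D (fob F X) (fob F Y)"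
    and far_ide: "X \<in> obj C \<Longrightarrow> far F (\<one>\<^bsub>C\<^esub> X) = \<one>\<^bsub>D\<^esub> (fob F X)"
    and far_cmp: "f \<in> hom C X Y \<Longrightarrow> g \<in> hom C Y Z \<Longrightarrow>
      far F (g \<cdot>\<^bsub>C\<^esub> f) = far F g \<cdot>\<^bsub>D\<^esub> far F f"


section \<open>Closed monoidal categories\<close>

record ('o, 'a) monoidal_data = "('o, 'a) precat" +
  tensor :: "('o \<times> 'o, 'a \<times> 'a, 'o, 'a) functor_data"
  unit :: 'o
  assoc :: "'o \<Rightarrow> 'o \<Rightarrow> 'o \<Rightarrow> 'a"
  lunit :: "'o \<Rightarrow> 'a"
  runit :: "'o \<Rightarrow> 'a"

abbreviation tensor_obj ::
    "('o, 'a, 'x) monoidal_data_scheme \<Rightarrow> 'o \<Rightarrow> 'o \<Rightarrow> 'o" (infixr \<open>\<otimes>\<index>\<close> 70) where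
  "X \<otimes>\<^bsub>V\<^esub> Y \<equiv> fob (tensor V) (X, Y)"

abbreviation tensor_arr ::
    "('o, 'a, 'x) monoidal_data_scheme \<Rightarrow> 'a \<Rightarrow> 'a \<Rightarrow> 'a" (infixr \<open>\<boxtimes>\<index>\<close> 70) where
  "f \<boxtimes>\<^bsub>V\<^esub> g \<equiv> far (tensor V) (f, g)"

locale monoidal_category = category V
  for V :: "('o, 'a, 'x) monoidal_data_scheme" (structure) +
  assumes tensor_functor: "is_functor (V \<times>\<^sub>c V) V (tensor V)"
    and unit_obj: "unit V \<in> obj V"
    and assoc_iso: "X \<in> obj V \<Longrightarrow> Y \<in> obj V \<Longrightarrow> Z \<in> obj V \<Longrightarrow>
      assoc V X Y Z \<in> isos V ((X \<otimes> Y) \<otimes> Z) (X \<otimes> (Y \<otimes> Z))"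
    and assoc_natural: "f \<in> hom V X X' \<Longrightarrow> g \<in> hom V Y Y' \<Longrightarrow> h \<in> hom V Z Z' \<Longrightarrow>
      assoc V X' Y' Z' \<cdot> ((f \<boxtimes> g) \<boxtimes> h) = (f \<boxtimes> (g \<boxtimes> h)) \<cdot> assoc V X Y Z"
    and lunit_iso: "X \<in> obj V \<Longrightarrow> lunit V X \<in> isos V (unit V \<otimes> X) X"
    and lunit_natural: "f \<in> hom V X Y \<Longrightarrow>
      lunit V Y \<cdot> (\<one> (unit V) \<boxtimes> f) = f \<cdot> lunit V X"
    and runit_iso: "X \<in> obj V \<Longrightarrow> runit V X \<in> isos V (X \<otimes> unit V) X"
    and runit_natural: "f \<in> hom V X Y \<Longrightarrow>
      runit V Y \<cdot> (f \<boxtimes> \<one> (unit V)) = f \<cdot> runit V X"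
    and pentagon: "W \<in> obj V \<Longrightarrow> X \<in> obj V \<Longrightarrow> Y \<in> obj V \<Longrightarrow> Z \<in> obj V \<Longrightarrow>
      assoc V W X (Y \<otimes> Z) \<cdot> assoc V (W \<otimes> X) Y Z =
      (\<one> W \<boxtimes> assoc V X Y Z) \<cdot> assoc V W (X \<otimes> Y) Z \<cdot> (assoc V W X Y \<boxtimes> \<one> Z)"
    and triangle: "X \<in> obj V \<Longrightarrow> Y \<in> obj V \<Longrightarrow>
      (\<one> X \<boxtimes> lunit V Y) \<cdot> assoc V X (unit V) Y = runit V X \<boxtimes> \<one> Y"

record ('o, 'a) closed_monoidal_data = "('o, 'a) monoidal_data" +
  ihom :: "('o \<times> 'o, 'a \<times> 'a, 'o, 'a) functor_data"
  adj :: "'o \<Rightarrow> 'o \<Rightarrow> 'o \<Rightarrow> 'a \<Rightarrow> 'a"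

text \<open>
  \<open>adj V X Y Z\<close> is the bijection \<open>\<pi>\<close> from \<open>V(X \<otimes> Y, Z)\<close> to \<open>V(X, ihom(Y, Z))\<close>.  Its naturality
  in \<open>X\<close> and \<open>Z\<close> says that \<open>ihom(Y, -)\<close> is right adjoint to \<open>- \<otimes> Y\<close>; its naturality in \<open>Y\<close>
  determines the contravariant action of the bifunctor \<open>ihom\<close>.
\<close>

locale closed_monoidal_category = monoidal_category V
  for V :: "('o, 'a, 'x) closed_monoidal_data_scheme" (structure) +
  assumes ihom_functor: "is_functor (op_cat V \<times>\<^sub>c V) V (ihom V)"
    and adj_bij: "X \<in> obj V \<Longrightarrow> Y \<in> obj V \<Longrightarrow> Z \<in> obj V \<Longrightarrow>
      bij_betw (adj V X Y Z) (hom V (X \<otimes> Y) Z) (hom V X (fob (ihom V) (Y, Z)))"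
    and adj_natural_left: "h \<in> hom V X' X \<Longrightarrow> Y \<in> obj V \<Longrightarrow> f \<in> hom V (X \<otimes> Y) Z \<Longrightarrow>
      adj V X' Y Z (f \<cdot> (h \<boxtimes> \<one> Y)) = adj V X Y Z f \<cdot> h"
    and adj_natural_right:
      "X \<in> obj V \<Longrightarrow> Y \<in> obj V \<Longrightarrow> f \<in> hom V (X \<otimes> Y) Z \<Longrightarrow> g \<in> hom V Z Z' \<Longrightarrow>
      adj V X Y Z' (g \<cdot> f) = far (ihom V) (\<one> Y, g) \<cdot> adj V X Y Z f"
    and adj_natural_middle: "X \<in> obj V \<Longrightarrow> k \<in> hom V Y' Y \<Longrightarrow> f \<in> hom V (X \<otimes> Y) Z \<Longrightarrow>
      adj V X Y' Z (f \<cdot> (\<one> X \<boxtimes> k)) = far (ihom V) (k, \<one> Z) \<cdot> adj V X Y Z f"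

definition counit :: "('o, 'a, 'x) closed_monoidal_data_scheme \<Rightarrow> 'o \<Rightarrow> 'o \<Rightarrow> 'a" where
  "counit V Y Z = inv_into (hom V (fob (ihom V) (Y, Z) \<otimes>\<^bsub>V\<^esub> Y) Z)
     (adj V (fob (ihom V) (Y, Z)) Y Z) (\<one>\<^bsub>V\<^esub> (fob (ihom V) (Y, Z)))"


section \<open>Categories with V-structure\<close>

text \<open>
  \<open>enr\<close> is the \<open>V\<close>-valued hom bifunctor, \<open>ecomp X Y Z\<close> the composition morphism
  from \<open>enr(Y, Z) \<otimes> enr(X, Y)\<close> to \<open>enr(X, Z)\<close>, and \<open>ephi\<close> the natural isomorphism from
  \<open>S(X, Y)\<close> to \<open>V(I, enr(X, Y))\<close> (the indices \<open>X\<close>, \<open>Y\<close> are determined by the arrow it is applied to).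
\<close>

record ('p, 'b, 'o, 'a) enriched_data = "('p, 'b) precat" +
  enr :: "('p \<times> 'p, 'b \<times> 'b, 'o, 'a) functor_data"
  ecomp :: "'p \<Rightarrow> 'p \<Rightarrow> 'p \<Rightarrow> 'a"
  ephi :: "'b \<Rightarrow> 'a"

locale category_with_structure = V: closed_monoidal_category V + S: category S
  for V :: "('o, 'a, 'x) closed_monoidal_data_scheme"
    and S :: "('p, 'b, 'o, 'a, 'y) enriched_data_scheme" +
  assumes enr_functor: "is_functor (op_cat S \<times>\<^sub>c S) V (enr S)"
    and ecomp_hom: "X \<in> obj S \<Longrightarrow> Y \<in> obj S \<Longrightarrow> Z \<in> obj S \<Longrightarrow>
      ecomp S X Y Z \<in> hom V (fob (enr S) (Y, Z) \<otimes>\<^bsub>V\<^esub> fob (enr S) (X, Y)) (fob (enr S) (X, Z))"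
    and ephi_bij: "X \<in> obj S \<Longrightarrow> Y \<in> obj S \<Longrightarrow>
      bij_betw (ephi S) (hom S X Y) (hom V (unit V) (fob (enr S) (X, Y)))"
    and ephi_natural: "f \<in> hom S X' X \<Longrightarrow> h \<in> hom S X Y \<Longrightarrow> g \<in> hom S Y Y' \<Longrightarrow>
      ephi S (g \<cdot>\<^bsub>S\<^esub> h \<cdot>\<^bsub>S\<^esub> f) = far (enr S) (f, g) \<cdot>\<^bsub>V\<^esub> ephi S h"
    and ecomp_assoc: "X \<in> obj S \<Longrightarrow> Y \<in> obj S \<Longrightarrow> Z \<in> obj S \<Longrightarrow> W \<in> obj S \<Longrightarrow>
      ecomp S X Y W \<cdot>\<^bsub>V\<^esub> (ecomp S Y Z W \<boxtimes>\<^bsub>V\<^esub> \<one>\<^bsub>V\<^esub> (fob (enr S) (X, Y))) =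
      ecomp S X Z W \<cdot>\<^bsub>V\<^esub> (\<one>\<^bsub>V\<^esub> (fob (enr S) (Z, W)) \<boxtimes>\<^bsub>V\<^esub> ecomp S X Y Z)
        \<cdot>\<^bsub>V\<^esub> assoc V (fob (enr S) (Z, W)) (fob (enr S) (Y, Z)) (fob (enr S) (X, Y))"
    and enr_contravariant: "f \<in> hom S X Y \<Longrightarrow> Z \<in> obj S \<Longrightarrow>
      far (enr S) (f, \<one>\<^bsub>S\<^esub> Z) =
      ecomp S X Y Z \<cdot>\<^bsub>V\<^esub> (\<one>\<^bsub>V\<^esub> (fob (enr S) (Y, Z)) \<boxtimes>\<^bsub>V\<^esub> ephi S f)
        \<cdot>\<^bsub>V\<^esub> inv_arr V (runit V (fob (enr S) (Y, Z)))"
    and enr_covariant: "X \<in> obj S \<Longrightarrow> g \<in> hom S Y Z \<Longrightarrow>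
      far (enr S) (\<one>\<^bsub>S\<^esub> X, g) =
      ecomp S X Y Z \<cdot>\<^bsub>V\<^esub> (ephi S g \<boxtimes>\<^bsub>V\<^esub> \<one>\<^bsub>V\<^esub> (fob (enr S) (X, Y)))
        \<cdot>\<^bsub>V\<^esub> inv_arr V (lunit V (fob (enr S) (X, Y)))"


section \<open>Cylinders\<close>

text \<open>\<open>is_cylinder V S K X P \<alpha> \<phi>\<close>: the triple \<open>(P, \<alpha>, (\<phi> Y)\<^sub>Y)\<close> is a \<open>K\<close>-cylinder of \<open>X\<close>.\<close>

definition is_cylinder ::
    "('o, 'a, 'x) closed_monoidal_data_scheme \<Rightarrow> ('p, 'b, 'o, 'a, 'y) enriched_data_scheme \<Rightarrow>
     'o \<Rightarrow> 'p \<Rightarrow> 'p \<Rightarrow> 'a \<Rightarrow> ('p \<Rightarrow> 'a) \<Rightarrow> bool" where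
  "is_cylinder V S K X P \<alpha> \<phi> \<longleftrightarrow>
     P \<in> obj S \<and>
     \<alpha> \<in> hom V K (fob (enr S) (X, P)) \<and>
     (\<forall>Y\<in>obj S.
        \<phi> Y \<in> isos V (fob (enr S) (P, Y)) (fob (ihom V) (K, fob (enr S) (X, Y))) \<and>
        counit V K (fob (enr S) (X, Y)) \<cdot>\<^bsub>V\<^esub> (\<phi> Y \<boxtimes>\<^bsub>V\<^esub> \<one>\<^bsub>V\<^esub> K) =
        ecomp S X P Y \<cdot>\<^bsub>V\<^esub> (\<one>\<^bsub>V\<^esub> (fob (enr S) (P, Y)) \<boxtimes>\<^bsub>V\<^esub> \<alpha>))"

definition is_cylinder_bifunctor ::
    "('o, 'a, 'x) closed_monoidal_data_scheme \<Rightarrow> ('p, 'b, 'o, 'a, 'y) enriched_data_scheme \<Rightarrow>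
     ('o \<Rightarrow> 'p \<Rightarrow> 'p) \<Rightarrow> ('o \<Rightarrow> 'p \<Rightarrow> 'a) \<Rightarrow> ('o \<times> 'p, 'a \<times> 'b, 'p, 'b) functor_data \<Rightarrow> bool" where
  "is_cylinder_bifunctor V S cyl \<alpha> T \<longleftrightarrow>
     is_functor (V \<times>\<^sub>c S) S T \<and>
     (\<forall>K\<in>obj V. \<forall>X\<in>obj S. fob T (K, X) = cyl K X) \<and>
     (\<forall>K\<in>obj V. \<forall>L\<in>obj V. \<forall>X\<in>obj S. \<forall>u\<in>hom V K L.
        far (enr S) (\<one>\<^bsub>S\<^esub> X, far T (u, \<one>\<^bsub>S\<^esub> X)) \<cdot>\<^bsub>V\<^esub> \<alpha> K X = \<alpha> L X \<cdot>\<^bsub>V\<^esub> u) \<and>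
     (\<forall>K\<in>obj V. \<forall>X\<in>obj S. \<forall>Y\<in>obj S. \<forall>v\<in>hom S X Y.
        far (enr S) (\<one>\<^bsub>S\<^esub> X, far T (\<one>\<^bsub>V\<^esub> K, v)) \<cdot>\<^bsub>V\<^esub> \<alpha> K X =
        far (enr S) (v, \<one>\<^bsub>S\<^esub> (cyl K Y)) \<cdot>\<^bsub>V\<^esub> \<alpha> K Y)"

end

theory Submission
  imports Defs
begin

text \<open>
  Transporting \<open>S(K \<otimes> X, Y)\<close> along \<open>ephi\<close>, \<open>\<phi>\<close>, the adjunction and the left unitor turns an arrow
  \<open>f\<close> into \<open>enr(X, f) \<cdot> \<alpha>\<close>, so \<open>\<alpha>\<close> is universal: every \<open>k : K \<rightarrow> enr(X, Y)\<close> is \<open>enr(X, f) \<cdot> \<alpha>\<close> for a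
  unique \<open>f\<close>.  The arrow \<open>t = u \<otimes> v\<close> is therefore determined by
  \<open>enr(X, t) \<cdot> \<alpha> = enr(v, L \<otimes> Y) \<cdot> \<alpha> \<cdot> u\<close>, a condition that specialises to the two prescribed ones and is
  stable under composition; this gives existence and uniqueness of the bifunctor.  Naturality
  of \<open>\<phi>\<close> is checked after transposing across the adjunction, where it reduces to the naturality of
  composition in the outer objects and its extranaturality in the middle one.  These follow from
  associativity together with the triangle and its two companions for the unitors of a tensor product.
\<close>

section \<open>Arrows and isomorphisms in a single category\<close>

context category
begin

lemma homI: "f \<in> arr C \<Longrightarrow> src C f = X \<Longrightarrow> tgt C f = Y \<Longrightarrow> f \<in> hom C X Y"
  by (simp add: hom_def)

lemma homD:
  assumes "f \<in> hom C X Y"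
  shows "f \<in> arr C" "src C f = X" "tgt C f = Y" "X \<in> obj C" "Y \<in> obj C"
  using assms src_obj tgt_obj by (auto simp: hom_def)

declare src_obj [simp] tgt_obj [simp]

lemma ide_arr [simp]:
  assumes "X \<in> obj C"
  shows "\<one> X \<in> arr C" "src C (\<one> X) = X" "tgt C (\<one> X) = X"
  using ide_hom [OF assms] by (auto simp: hom_def)

lemma cmp_arr [simp]:
  assumes "f \<in> arr C" "g \<in> arr C" "src C g = tgt C f"
  shows "g \<cdot> f \<in> arr C" "src C (g \<cdot> f) = src C f" "tgt C (g \<cdot> f) = tgt C g"
  using cmp_hom [of f "src C f" "tgt C f" g "tgt C g"] assms by (auto simp: hom_def)

lemma cmp_ide [simp]:
  assumes "f \<in> arr C"
  shows "src C f = X \<Longrightarrow> f \<cdot> \<one> X = f" "tgt C f = Y \<Longrightarrow> \<one> Y \<cdot> f = f"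
  using assms cmp_ide_right cmp_ide_left by (auto simp: hom_def)

text \<open>Makes right-nested composites the normal form. The guards are equations between sources
  and targets, which rewriting can decide; membership in hom-sets would require guessing the
  intermediate objects.\<close>

lemma cmp_assoc_arr [simp]:
  assumes "f \<in> arr C" "g \<in> arr C" "h \<in> arr C" "src C g = tgt C f" "src C h = tgt C g"
  shows "(h \<cdot> g) \<cdot> f = h \<cdot> (g \<cdot> f)"
  using cmp_assoc [of f "src C f" "tgt C f" g "tgt C g" h "tgt C h"] assms by (auto simp: hom_def)

text \<open>Inverses are unique, since
  \<open>h = h \<cdot> (f \<cdot> g) = (h \<cdot> f) \<cdot> g = g\<close>, so the definite
  description in \<open>inv_arr\<close> denotes.\<close>

lemma inverse_arrows_inv_arr:
  assumes "f \<in> isos C X Y"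
  shows "inverse_arrows C f (inv_arr C f)"
  unfolding inv_arr_def
proof (rule theI')
  from assms obtain g where g: "inverse_arrows C f g"
    by (auto simp: isos_def)
  show "\<exists>!g. inverse_arrows C f g"
  proof (rule ex1I [where a = g])
    show "inverse_arrows C f g" by (fact g)
  next
    fix h assume h: "inverse_arrows C f h"
    have "h = h \<cdot> (f \<cdot> g)"
      using g h by (auto simp: inverse_arrows_def hom_def)
    also have "\<dots> = (h \<cdot> f) \<cdot> g"
      using g h by (subst cmp_assoc_arr) (auto simp: inverse_arrows_def hom_def)
    also have "\<dots> = g"
      using g h by (auto simp: inverse_arrows_def hom_def)
    finally show "h = g" .
  qed
qed

lemma isos_arr:
  assumes "f \<in> isos C X Y"
  shows "f \<in> arr C" "src C f = X" "tgt C f = Y"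
  using assms by (auto simp: isos_def hom_def)

lemma inv_arr_arr:
  assumes "f \<in> isos C X Y"
  shows "inv_arr C f \<in> arr C" "src C (inv_arr C f) = Y" "tgt C (inv_arr C f) = X"
    "inv_arr C f \<cdot> f = \<one> X" "f \<cdot> inv_arr C f = \<one> Y"
  using inverse_arrows_inv_arr [OF assms] isos_arr [OF assms]
  by (auto simp: inverse_arrows_def hom_def)

lemma isos_cancel_left:
  assumes "f \<in> isos C Y Z" "g \<in> hom C X Y" "h \<in> hom C X Y" "f \<cdot> g = f \<cdot> h"
  shows "g = h"
proof -
  note [simp] = isos_arr [OF assms(1)] inv_arr_arr [OF assms(1)] homD [OF assms(2)]
    homD [OF assms(3)]
  have "g = (inv_arr C f \<cdot> f) \<cdot> g"
    by simp
  also have "\<dots> = inv_arr C f \<cdot> (f \<cdot> h)"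
    by (subst cmp_assoc_arr) (simp_all add: assms(4))
  also have "\<dots> = (inv_arr C f \<cdot> f) \<cdot> h"
    by (subst cmp_assoc_arr) simp_all
  finally show ?thesis
    by simp
qed

lemma isos_cancel_right:
  assumes "f \<in> isos C X Y" "g \<in> hom C Y Z" "h \<in> hom C Y Z" "g \<cdot> f = h \<cdot> f"
  shows "g = h"
proof -
  note [simp] = isos_arr [OF assms(1)] inv_arr_arr [OF assms(1)] homD [OF assms(2)]
    homD [OF assms(3)]
  have "(g \<cdot> f) \<cdot> inv_arr C f = (h \<cdot> f) \<cdot> inv_arr C f"
    by (simp only: assms(4))
  then show ?thesis
    by simp
qed

end

section \<open>Product categories, opposite categories and functors\<close>

lemma prod_cat_simps [simp]:
  "obj (C \<times>\<^sub>c D) = obj C \<times> obj D"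
  "arr (C \<times>\<^sub>c D) = arr C \<times> arr D"
  "src (C \<times>\<^sub>c D) = map_prod (src C) (src D)"
  "tgt (C \<times>\<^sub>c D) = map_prod (tgt C) (tgt D)"
  "ide (C \<times>\<^sub>c D) = map_prod (ide C) (ide D)"
  "cmp (C \<times>\<^sub>c D) (g, k) (f, h) = (g \<cdot>\<^bsub>C\<^esub> f, k \<cdot>\<^bsub>D\<^esub> h)"
  by (simp_all add: prod_cat_def)

lemma op_cat_simps [simp]:
  "obj (op_cat C) = obj C" "arr (op_cat C) = arr C"
  "src (op_cat C) = tgt C" "tgt (op_cat C) = src C"
  "ide (op_cat C) = ide C" "cmp (op_cat C) g f = f \<cdot>\<^bsub>C\<^esub> g"
  by (simp_all add: op_cat_def)

lemma category_prod_cat: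
  assumes "category C" "category D"
  shows "category (C \<times>\<^sub>c D)"
proof -
  interpret C: category C by fact
  interpret D: category D by fact
  show ?thesis
    by unfold_locales (auto simp: hom_def)
qed

lemma (in is_functor) far_arr:
  assumes "f \<in> arr C"
  shows "far F f \<in> arr D" "src D (far F f) = fob F (src C f)" "tgt D (far F f) = fob F (tgt C f)"
  using far_hom [of f "src C f" "tgt C f"] assms by (auto simp: hom_def)

lemma (in is_functor) far_cmp_arr:
  assumes "f \<in> arr C" "g \<in> arr C" "src C g = tgt C f"
  shows "far F g \<cdot>\<^bsub>D\<^esub> far F f = far F (g \<cdot>\<^bsub>C\<^esub> f)"
  using far_cmp [of f "src C f" "tgt C f" g "tgt C g"] assms by (auto simp: hom_def)

section \<open>Monoidal categories and the coherence of unitors\<close>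

context monoidal_category
begin

interpretation T: is_functor "V \<times>\<^sub>c V" V "tensor V"
  by (rule tensor_functor)

declare unit_obj [simp]

lemma tensor_obj_closed [simp]: "X \<in> obj V \<Longrightarrow> Y \<in> obj V \<Longrightarrow> X \<otimes> Y \<in> obj V"
  using T.fob_obj [of "(X, Y)"] by simp

lemma tensor_arr_closed [simp]:
  assumes "f \<in> arr V" "g \<in> arr V"
  shows "f \<boxtimes> g \<in> arr V" "src V (f \<boxtimes> g) = src V f \<otimes> src V g" "tgt V (f \<boxtimes> g) = tgt V f \<otimes> tgt V g"
  using T.far_arr [of "(f, g)"] assms by simp_all

lemma tensor_ide: "X \<in> obj V \<Longrightarrow> Y \<in> obj V \<Longrightarrow> \<one> X \<boxtimes> \<one> Y = \<one> (X \<otimes> Y)"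
  using T.far_ide [of "(X, Y)"] by simp

lemma interchange:
  assumes "f \<in> arr V" "g \<in> arr V" "h \<in> arr V" "k \<in> arr V" "src V g = tgt V f" "src V k = tgt V h"
  shows "(g \<boxtimes> k) \<cdot> (f \<boxtimes> h) = (g \<cdot> f) \<boxtimes> (k \<cdot> h)"
  using T.far_cmp_arr [of "(f, h)" "(g, k)"] assms by simp

text \<open>The form of \<open>interchange\<close> suited to right-nested composites, where the two
  tensor products are followed by a tail \<open>x\<close>.\<close>

lemma interchange_assoc:
  assumes "f \<in> arr V" "g \<in> arr V" "h \<in> arr V" "k \<in> arr V" "src V g = tgt V f" "src V k = tgt V h"
    "x \<in> arr V" "tgt V x = src V f \<otimes> src V h"
  shows "(g \<boxtimes> k) \<cdot> ((f \<boxtimes> h) \<cdot> x) = ((g \<cdot> f) \<boxtimes> (k \<cdot> h)) \<cdot> x"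
  using assms by (simp flip: cmp_assoc_arr add: interchange del: cmp_assoc_arr)

lemmas assoc_arr [simp] = isos_arr [OF assoc_iso]
lemmas lunit_arr [simp] = isos_arr [OF lunit_iso] inv_arr_arr [OF lunit_iso]
lemmas runit_arr [simp] = isos_arr [OF runit_iso] inv_arr_arr [OF runit_iso]

lemma assoc_natural_arr:
  assumes "f \<in> arr V" "g \<in> arr V" "h \<in> arr V"
  shows "assoc V (tgt V f) (tgt V g) (tgt V h) \<cdot> ((f \<boxtimes> g) \<boxtimes> h) =
    (f \<boxtimes> (g \<boxtimes> h)) \<cdot> assoc V (src V f) (src V g) (src V h)"
  using assms by (intro assoc_natural homI) auto

lemma isos_tensor_ide:
  assumes "f \<in> isos V X Y" "Z \<in> obj V"
  shows "f \<boxtimes> \<one> Z \<in> isos V (X \<otimes> Z) (Y \<otimes> Z)"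
proof -
  note [simp] = isos_arr [OF assms(1)] inv_arr_arr [OF assms(1)]
  have [simp]: "X \<in> obj V" "Y \<in> obj V"
    using src_obj [of f] tgt_obj [of f] by auto
  have "inverse_arrows V (f \<boxtimes> \<one> Z) (inv_arr V f \<boxtimes> \<one> Z)"
    using assms(2) by (simp add: inverse_arrows_def hom_def interchange tensor_ide)
  then show ?thesis
    using assms(2) by (auto simp: isos_def hom_def)
qed

text \<open>The right unitor is a natural isomorphism from tensoring with the unit to the identity
  functor, so tensoring with the unit is faithful. Coherence laws may therefore be checked after
  tensoring with the unit.\<close>

lemma tensor_unit_right_inj:
  assumes "f \<in> hom V X Y" "g \<in> hom V X Y" "f \<boxtimes> \<one> (unit V) = g \<boxtimes> \<one> (unit V)"
  shows "f = g"
proof (rule isos_cancel_right [OF runit_iso])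
  show "f \<cdot> runit V X = g \<cdot> runit V X"
    using assms by (metis runit_natural)
qed (use assms homD in auto)

lemma tensor_unit_left_inj:
  assumes "f \<in> hom V X Y" "g \<in> hom V X Y" "\<one> (unit V) \<boxtimes> f = \<one> (unit V) \<boxtimes> g"
  shows "f = g"
proof (rule isos_cancel_right [OF lunit_iso])
  show "f \<cdot> lunit V X = g \<cdot> lunit V X"
    using assms by (metis lunit_natural)
qed (use assms homD in auto)

text \<open>
  The next two coherence laws are Kelly's: each is the pentagon with one object equal to the unit,
  composed with a left unitor and simplified by the triangle.
\<close>

lemma runit_tensor:
  assumes [simp]: "X \<in> obj V" "Y \<in> obj V"
  shows "runit V (X \<otimes> Y) = (\<one> X \<boxtimes> runit V Y) \<cdot> assoc V X Y (unit V)"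
proof (rule tensor_unit_right_inj)
  let ?I = "unit V"
  show "runit V (X \<otimes> Y) \<boxtimes> \<one> ?I = ((\<one> X \<boxtimes> runit V Y) \<cdot> assoc V X Y ?I) \<boxtimes> \<one> ?I"
  proof (rule isos_cancel_left [OF assoc_iso [of X Y ?I]])
    \<comment> \<open>The triangle read backwards trades the right unitor of
      \<open>X \<otimes> Y\<close> for \<open>lunit V ?I\<close> and an associator; after naturality
      the two associators form the shorter side of the pentagon on \<open>X\<close>,
      \<open>Y\<close>, \<open>?I\<close>, \<open>?I\<close>.\<close>
    have "assoc V X Y ?I \<cdot> (runit V (X \<otimes> Y) \<boxtimes> \<one> ?I) =
        assoc V X Y ?I \<cdot> ((\<one> X \<boxtimes> \<one> Y) \<boxtimes> lunit V ?I) \<cdot> assoc V (X \<otimes> Y) ?I ?I"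
      by (simp add: tensor_ide flip: triangle)
    also have "\<dots> = (\<one> X \<boxtimes> (\<one> Y \<boxtimes> lunit V ?I)) \<cdot> assoc V X Y (?I \<otimes> ?I) \<cdot> assoc V (X \<otimes> Y) ?I ?I"
      using assoc_natural_arr [of "\<one> X" "\<one> Y" "lunit V ?I"] by simp
    also have "\<dots> = (\<one> X \<boxtimes> (\<one> Y \<boxtimes> lunit V ?I)) \<cdot>
        ((\<one> X \<boxtimes> assoc V Y ?I ?I) \<cdot> assoc V X (Y \<otimes> ?I) ?I \<cdot> (assoc V X Y ?I \<boxtimes> \<one> ?I))"
      by (simp add: pentagon)
    also have "\<dots> = (\<one> X \<boxtimes> (runit V Y \<boxtimes> \<one> ?I)) \<cdot> assoc V X (Y \<otimes> ?I) ?I \<cdot> (assoc V X Y ?I \<boxtimes> \<one> ?I)"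
      by (simp add: interchange_assoc triangle)
    also have "\<dots> = assoc V X Y ?I \<cdot> ((\<one> X \<boxtimes> runit V Y) \<boxtimes> \<one> ?I) \<cdot> (assoc V X Y ?I \<boxtimes> \<one> ?I)"
      using assoc_natural_arr [of "\<one> X" "runit V Y" "\<one> ?I"] by simp
    also have "\<dots> = assoc V X Y ?I \<cdot> (((\<one> X \<boxtimes> runit V Y) \<cdot> assoc V X Y ?I) \<boxtimes> \<one> ?I)"
      by (simp add: interchange)
    finally show "assoc V X Y ?I \<cdot> (runit V (X \<otimes> Y) \<boxtimes> \<one> ?I) =
      assoc V X Y ?I \<cdot> (((\<one> X \<boxtimes> runit V Y) \<cdot> assoc V X Y ?I) \<boxtimes> \<one> ?I)" .
  qed (auto intro!: homI)
qed (auto intro!: homI)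

lemma lunit_tensor:
  assumes [simp]: "X \<in> obj V" "Y \<in> obj V"
  shows "lunit V X \<boxtimes> \<one> Y = lunit V (X \<otimes> Y) \<cdot> assoc V (unit V) X Y"
proof (rule tensor_unit_left_inj)
  let ?I = "unit V"
  let ?a = "assoc V ?I (?I \<otimes> X) Y"
  show "\<one> ?I \<boxtimes> (lunit V X \<boxtimes> \<one> Y) = \<one> ?I \<boxtimes> (lunit V (X \<otimes> Y) \<cdot> assoc V ?I X Y)"
  \<comment> \<open>The two isomorphisms cancelled on the right, here and in the nested proof,
    complete \<open>\<one> ?I \<boxtimes> assoc V ?I X Y\<close> to the longer side of the pentagon
    on \<open>?I\<close>, \<open>?I\<close>, \<open>X\<close>, \<open>Y\<close>.\<close>
  proof (rule isos_cancel_right [OF assoc_iso [of ?I "?I \<otimes> X" Y]])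
    show "(\<one> ?I \<boxtimes> (lunit V X \<boxtimes> \<one> Y)) \<cdot> ?a = (\<one> ?I \<boxtimes> (lunit V (X \<otimes> Y) \<cdot> assoc V ?I X Y)) \<cdot> ?a"
    proof (rule isos_cancel_right [OF isos_tensor_ide [OF assoc_iso [of ?I ?I X], of Y]])
      have "(\<one> ?I \<boxtimes> (lunit V X \<boxtimes> \<one> Y)) \<cdot> ?a \<cdot> (assoc V ?I ?I X \<boxtimes> \<one> Y) =
          assoc V ?I X Y \<cdot> ((\<one> ?I \<boxtimes> lunit V X) \<boxtimes> \<one> Y) \<cdot> (assoc V ?I ?I X \<boxtimes> \<one> Y)"
        using assoc_natural_arr [of "\<one> ?I" "lunit V X" "\<one> Y"] by simp
      also have "\<dots> = assoc V ?I X Y \<cdot> ((runit V ?I \<boxtimes> \<one> X) \<boxtimes> \<one> Y)"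
        by (simp add: interchange triangle)
      also have "\<dots> = (runit V ?I \<boxtimes> \<one> (X \<otimes> Y)) \<cdot> assoc V (?I \<otimes> ?I) X Y"
        using assoc_natural_arr [of "runit V ?I" "\<one> X" "\<one> Y"] by (simp add: tensor_ide)
      also have "\<dots> = (\<one> ?I \<boxtimes> lunit V (X \<otimes> Y)) \<cdot> (assoc V ?I ?I (X \<otimes> Y) \<cdot> assoc V (?I \<otimes> ?I) X Y)"
        by (simp flip: triangle)
      also have "\<dots> = (\<one> ?I \<boxtimes> (lunit V (X \<otimes> Y) \<cdot> assoc V ?I X Y)) \<cdot> ?a \<cdot> (assoc V ?I ?I X \<boxtimes> \<one> Y)"
        by (simp add: pentagon interchange_assoc)
      finally show "(\<one> ?I \<boxtimes> (lunit V X \<boxtimes> \<one> Y)) \<cdot> ?a \<cdot> (assoc V ?I ?I X \<boxtimes> \<one> Y) =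
        (\<one> ?I \<boxtimes> (lunit V (X \<otimes> Y) \<cdot> assoc V ?I X Y)) \<cdot> ?a \<cdot> (assoc V ?I ?I X \<boxtimes> \<one> Y)" .
    qed (auto intro!: homI)
  qed (auto intro!: homI)
qed (auto intro!: homI)

end

section \<open>Closed monoidal categories: transposition through the counit\<close>

abbreviation (input) ihom_obj where "ihom_obj V Y Z \<equiv> fob (ihom V) (Y, Z)"

context closed_monoidal_category
begin

interpretation H: is_functor "op_cat V \<times>\<^sub>c V" V "ihom V"
  by (rule ihom_functor)

lemma ihom_obj_closed [simp]: "Y \<in> obj V \<Longrightarrow> Z \<in> obj V \<Longrightarrow> ihom_obj V Y Z \<in> obj V"
  using H.fob_obj [of "(Y, Z)"] by simp

lemma ihom_arr_closed [simp]:
  assumes "f \<in> arr V" "g \<in> arr V"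
  shows "far (ihom V) (f, g) \<in> arr V"
    "src V (far (ihom V) (f, g)) = ihom_obj V (tgt V f) (src V g)"
    "tgt V (far (ihom V) (f, g)) = ihom_obj V (src V f) (tgt V g)"
  using H.far_arr [of "(f, g)"] assms by simp_all

lemma adj_inj:
  assumes "X \<in> obj V" "Y \<in> obj V" "f \<in> hom V (X \<otimes> Y) Z" "g \<in> hom V (X \<otimes> Y) Z"
    "adj V X Y Z f = adj V X Y Z g"
  shows "f = g"
  using adj_bij [of X Y Z] assms homD(5) [OF assms(3)]
  by (auto simp: bij_betw_def dest: inj_onD)

lemma adj_arr:
  assumes "X \<in> obj V" "Y \<in> obj V" "f \<in> hom V (X \<otimes> Y) Z"
  shows "adj V X Y Z f \<in> hom V X (ihom_obj V Y Z)"
  using adj_bij [of X Y Z] assms homD(5) [OF assms(3)] by (auto simp: bij_betw_def)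

lemma
  assumes [simp]: "Y \<in> obj V" "Z \<in> obj V"
  shows counit_hom: "counit V Y Z \<in> hom V (ihom_obj V Y Z \<otimes> Y) Z"
    and adj_counit: "adj V (ihom_obj V Y Z) Y Z (counit V Y Z) = \<one> (ihom_obj V Y Z)"
proof -
  \<comment> \<open>\<open>counit\<close> is given by \<open>inv_into\<close>, which yields a
    preimage only on the image; surjectivity of \<open>adj\<close> puts the identity there.\<close>
  have *: "\<one> (ihom_obj V Y Z) \<in> adj V (ihom_obj V Y Z) Y Z ` hom V (ihom_obj V Y Z \<otimes> Y) Z"
    using adj_bij [of "ihom_obj V Y Z" Y Z] ide_hom [of "ihom_obj V Y Z"]
    by (simp add: bij_betw_def)
  show "counit V Y Z \<in> hom V (ihom_obj V Y Z \<otimes> Y) Z"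
    "adj V (ihom_obj V Y Z) Y Z (counit V Y Z) = \<one> (ihom_obj V Y Z)"
    unfolding counit_def using inv_into_into [OF *] f_inv_into_f [OF *] by auto
qed

lemmas counit_arr [simp] = homD(1-3) [OF counit_hom]

text \<open>Naturality of \<open>adj\<close> in its first object, applied to the counit, whose
  transpose is the identity.\<close>

lemma adj_counit_tensor:
  assumes [simp]: "Y \<in> obj V" "Z \<in> obj V" and g: "g \<in> hom V X (ihom_obj V Y Z)"
  shows "adj V X Y Z (counit V Y Z \<cdot> (g \<boxtimes> \<one> Y)) = g"
  using adj_natural_left [OF g _ counit_hom [of Y Z]] homD [OF g] by (simp add: adj_counit)

text \<open>An arrow into an internal hom is recovered from its evaluation by
  \<open>adj_counit_tensor\<close>. Equations between such arrows, in particular the naturality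
  squares for \<phi>, can thus be tested after evaluation.\<close>

lemma counit_tensor_inj:
  assumes "Y \<in> obj V" "Z \<in> obj V" "g \<in> hom V X (ihom_obj V Y Z)" "h \<in> hom V X (ihom_obj V Y Z)"
    "counit V Y Z \<cdot> (g \<boxtimes> \<one> Y) = counit V Y Z \<cdot> (h \<boxtimes> \<one> Y)"
  shows "g = h"
  using assms adj_counit_tensor by metis

text \<open>Both sides have the transpose \<open>adj V X Y Z f\<close>, and transposition is
  injective.\<close>

lemma counit_adj:
  assumes [simp]: "X \<in> obj V" "Y \<in> obj V" and f: "f \<in> hom V (X \<otimes> Y) Z"
  shows "counit V Y Z \<cdot> (adj V X Y Z f \<boxtimes> \<one> Y) = f"
proof (rule adj_inj [of X Y _ Z])
  have Z [simp]: "Z \<in> obj V"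
    using homD [OF f] by simp
  note adj = adj_arr [OF assms]
  note [simp] = homD [OF adj]
  show "adj V X Y Z (counit V Y Z \<cdot> (adj V X Y Z f \<boxtimes> \<one> Y)) = adj V X Y Z f"
    by (rule adj_counit_tensor [OF _ Z adj]) simp
  show "counit V Y Z \<cdot> (adj V X Y Z f \<boxtimes> \<one> Y) \<in> hom V (X \<otimes> Y) Z"
    by (auto intro!: homI)
qed (use f in auto)

text \<open>Combines naturality of evaluation in \<open>Z\<close> with extranaturality in
  \<open>Y\<close>. Both sides transpose to \<open>far (ihom V) (k, g)\<close>, the right one
  because \<open>adj\<close> is natural in its second and third objects and the internal hom is a
  bifunctor.\<close>

lemma counit_natural:
  assumes k: "k \<in> hom V Y' Y" and g: "g \<in> hom V Z Z'"
  shows "counit V Y' Z' \<cdot> (far (ihom V) (k, g) \<boxtimes> \<one> Y') =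
    g \<cdot> counit V Y Z \<cdot> (\<one> (ihom_obj V Y Z) \<boxtimes> k)"
proof (rule adj_inj [of "ihom_obj V Y Z" Y' _ Z'])
  note [simp] = homD [OF k] homD [OF g]
  have "adj V (ihom_obj V Y Z) Y' Z' (g \<cdot> (counit V Y Z \<cdot> (\<one> (ihom_obj V Y Z) \<boxtimes> k))) =
      far (ihom V) (\<one> Y', g) \<cdot> far (ihom V) (k, \<one> Z)"
    by (subst adj_natural_right [OF _ _ _ g])
      (simp_all add: homI adj_natural_middle [OF _ k counit_hom] adj_counit)
  also have "\<dots> = far (ihom V) (k, g)"
    by (subst H.far_cmp_arr) simp_all
  finally show "adj V (ihom_obj V Y Z) Y' Z' (counit V Y' Z' \<cdot> (far (ihom V) (k, g) \<boxtimes> \<one> Y')) =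
    adj V (ihom_obj V Y Z) Y' Z' (g \<cdot> counit V Y Z \<cdot> (\<one> (ihom_obj V Y Z) \<boxtimes> k))"
    by (subst adj_counit_tensor) (simp_all add: homI)
qed (use homD [OF k] homD [OF g] in \<open>auto intro!: homI\<close>)

end

section \<open>Naturality and extranaturality of enriched composition\<close>

abbreviation (input) enr_obj where "enr_obj S X Y \<equiv> fob (enr S) (X, Y)"

context category_with_structure
begin

interpretation E: is_functor "op_cat S \<times>\<^sub>c S" V "enr S"
  by (rule enr_functor)

lemma enr_obj_closed [simp]: "X \<in> obj S \<Longrightarrow> Y \<in> obj S \<Longrightarrow> enr_obj S X Y \<in> obj V"
  using E.fob_obj [of "(X, Y)"] by simp

lemma enr_arr_closed [simp]:
  assumes "f \<in> arr S" "g \<in> arr S"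
  shows "far (enr S) (f, g) \<in> arr V"
    "src V (far (enr S) (f, g)) = enr_obj S (tgt S f) (src S g)"
    "tgt V (far (enr S) (f, g)) = enr_obj S (src S f) (tgt S g)"
  using E.far_arr [of "(f, g)"] assms by simp_all

lemma enr_ide: "X \<in> obj S \<Longrightarrow> Y \<in> obj S \<Longrightarrow> far (enr S) (\<one>\<^bsub>S\<^esub> X, \<one>\<^bsub>S\<^esub> Y) = \<one>\<^bsub>V\<^esub> (enr_obj S X Y)"
  using E.far_ide [of "(X, Y)"] by simp

lemma enr_cmp:
  assumes "f \<in> arr S" "g \<in> arr S" "h \<in> arr S" "k \<in> arr S" "src S f = tgt S g" "src S k = tgt S h"
  shows "far (enr S) (g, k) \<cdot>\<^bsub>V\<^esub> far (enr S) (f, h) = far (enr S) (f \<cdot>\<^bsub>S\<^esub> g, k \<cdot>\<^bsub>S\<^esub> h)"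
  using E.far_cmp_arr [of "(f, h)" "(g, k)"] assms by simp

lemma enr_cmp_assoc:
  assumes "f \<in> arr S" "g \<in> arr S" "h \<in> arr S" "k \<in> arr S" "src S f = tgt S g" "src S k = tgt S h"
    "x \<in> arr V" "tgt V x = enr_obj S (tgt S f) (src S h)"
  shows "far (enr S) (g, k) \<cdot>\<^bsub>V\<^esub> (far (enr S) (f, h) \<cdot>\<^bsub>V\<^esub> x) = far (enr S) (f \<cdot>\<^bsub>S\<^esub> g, k \<cdot>\<^bsub>S\<^esub> h) \<cdot>\<^bsub>V\<^esub> x"
  using assms by (simp flip: V.cmp_assoc_arr add: enr_cmp del: V.cmp_assoc_arr)

lemmas ecomp_arr [simp] = V.homD(1-3) [OF ecomp_hom]

lemma ephi_hom: "f \<in> hom S X Y \<Longrightarrow> ephi S f \<in> hom V (unit V) (enr_obj S X Y)"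
  using ephi_bij [of X Y] S.homD [of f X Y] by (auto simp: bij_betw_def)

lemma ephi_arr [simp]:
  assumes "f \<in> arr S"
  shows "ephi S f \<in> arr V" "src V (ephi S f) = unit V" "tgt V (ephi S f) = enr_obj S (src S f) (tgt S f)"
  using V.homD [OF ephi_hom [of f "src S f" "tgt S f"]] assms by (auto simp: hom_def)

lemma enr_contravariant_arr:
  assumes "f \<in> arr S" "Z \<in> obj S"
  shows "far (enr S) (f, \<one>\<^bsub>S\<^esub> Z) = ecomp S (src S f) (tgt S f) Z \<cdot>\<^bsub>V\<^esub>
    ((\<one>\<^bsub>V\<^esub> (enr_obj S (tgt S f) Z) \<boxtimes>\<^bsub>V\<^esub> ephi S f) \<cdot>\<^bsub>V\<^esub> inv_arr V (runit V (enr_obj S (tgt S f) Z)))"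
  using enr_contravariant [of f "src S f" "tgt S f" Z] assms by (simp add: hom_def)

lemma enr_covariant_arr:
  assumes "g \<in> arr S" "X \<in> obj S"
  shows "far (enr S) (\<one>\<^bsub>S\<^esub> X, g) = ecomp S X (src S g) (tgt S g) \<cdot>\<^bsub>V\<^esub>
    ((ephi S g \<boxtimes>\<^bsub>V\<^esub> \<one>\<^bsub>V\<^esub> (enr_obj S X (src S g))) \<cdot>\<^bsub>V\<^esub> inv_arr V (lunit V (enr_obj S X (src S g))))"
  using enr_covariant [of X g "src S g" "tgt S g"] assms by (simp add: hom_def)

text \<open>By \<open>enr_contravariant\<close> and \<open>enr_covariant\<close> both sides insert
  \<open>ephi S f\<close> between the two factors; \<open>ecomp_assoc\<close> shifts the bracket,
  and the triangle reconciles the right unitor of one factor with the left unitor of the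
  other.\<close>

lemma ecomp_extranatural:
  assumes f: "f \<in> hom S P Q" and [simp]: "X \<in> obj S" "Y \<in> obj S"
  shows "ecomp S X P Y \<cdot>\<^bsub>V\<^esub> (far (enr S) (f, \<one>\<^bsub>S\<^esub> Y) \<boxtimes>\<^bsub>V\<^esub> \<one>\<^bsub>V\<^esub> (enr_obj S X P)) =
    ecomp S X Q Y \<cdot>\<^bsub>V\<^esub> (\<one>\<^bsub>V\<^esub> (enr_obj S Q Y) \<boxtimes>\<^bsub>V\<^esub> far (enr S) (\<one>\<^bsub>S\<^esub> X, f))"
proof -
  note [simp] = S.homD [OF f]
  let ?A = "enr_obj S Q Y" and ?B = "enr_obj S X P"
  \<comment> \<open>The triangle in inverted form: after inserting \<open>lunit\<close> and its
    inverse in the right factor, \<open>lunit\<close> and the associator combine to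
    \<open>runit\<close>, which meets its inverse.\<close>
  have unitors: "assoc V ?A (unit V) ?B \<cdot>\<^bsub>V\<^esub> (inv_arr V (runit V ?A) \<boxtimes>\<^bsub>V\<^esub> \<one>\<^bsub>V\<^esub> ?B) =
      \<one>\<^bsub>V\<^esub> ?A \<boxtimes>\<^bsub>V\<^esub> inv_arr V (lunit V ?B)" (is "?L = ?R")
  proof -
    have "?L = (\<one>\<^bsub>V\<^esub> ?A \<boxtimes>\<^bsub>V\<^esub> (inv_arr V (lunit V ?B) \<cdot>\<^bsub>V\<^esub> lunit V ?B)) \<cdot>\<^bsub>V\<^esub> ?L"
      by (simp add: V.tensor_ide)
    also have "\<dots> = ?R \<cdot>\<^bsub>V\<^esub> (((\<one>\<^bsub>V\<^esub> ?A \<boxtimes>\<^bsub>V\<^esub> lunit V ?B) \<cdot>\<^bsub>V\<^esub> assoc V ?A (unit V) ?B) \<cdot>\<^bsub>V\<^esub>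
        (inv_arr V (runit V ?A) \<boxtimes>\<^bsub>V\<^esub> \<one>\<^bsub>V\<^esub> ?B))"
      by (simp add: V.interchange_assoc)
    also have "\<dots> = ?R"
      by (subst V.triangle) (simp_all add: V.interchange)
    finally show ?thesis .
  qed
  let ?p = "ephi S f"
  have "ecomp S X P Y \<cdot>\<^bsub>V\<^esub> (far (enr S) (f, \<one>\<^bsub>S\<^esub> Y) \<boxtimes>\<^bsub>V\<^esub> \<one>\<^bsub>V\<^esub> ?B) =
      (ecomp S X P Y \<cdot>\<^bsub>V\<^esub> (ecomp S P Q Y \<boxtimes>\<^bsub>V\<^esub> \<one>\<^bsub>V\<^esub> ?B)) \<cdot>\<^bsub>V\<^esub>
        (((\<one>\<^bsub>V\<^esub> ?A \<boxtimes>\<^bsub>V\<^esub> ?p) \<boxtimes>\<^bsub>V\<^esub> \<one>\<^bsub>V\<^esub> ?B) \<cdot>\<^bsub>V\<^esub> (inv_arr V (runit V ?A) \<boxtimes>\<^bsub>V\<^esub> \<one>\<^bsub>V\<^esub> ?B))"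
    by (simp add: enr_contravariant_arr V.interchange)
  also have "\<dots> = ecomp S X Q Y \<cdot>\<^bsub>V\<^esub> (\<one>\<^bsub>V\<^esub> ?A \<boxtimes>\<^bsub>V\<^esub> ecomp S X P Q) \<cdot>\<^bsub>V\<^esub>
      (assoc V ?A (enr_obj S P Q) ?B \<cdot>\<^bsub>V\<^esub> ((\<one>\<^bsub>V\<^esub> ?A \<boxtimes>\<^bsub>V\<^esub> ?p) \<boxtimes>\<^bsub>V\<^esub> \<one>\<^bsub>V\<^esub> ?B)) \<cdot>\<^bsub>V\<^esub>
      (inv_arr V (runit V ?A) \<boxtimes>\<^bsub>V\<^esub> \<one>\<^bsub>V\<^esub> ?B)"
    by (subst ecomp_assoc) simp_all
  also have "\<dots> = ecomp S X Q Y \<cdot>\<^bsub>V\<^esub> (\<one>\<^bsub>V\<^esub> ?A \<boxtimes>\<^bsub>V\<^esub> ecomp S X P Q) \<cdot>\<^bsub>V\<^esub>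
      (\<one>\<^bsub>V\<^esub> ?A \<boxtimes>\<^bsub>V\<^esub> (?p \<boxtimes>\<^bsub>V\<^esub> \<one>\<^bsub>V\<^esub> ?B)) \<cdot>\<^bsub>V\<^esub> ?R"
    using V.assoc_natural_arr [of "\<one>\<^bsub>V\<^esub> ?A" ?p "\<one>\<^bsub>V\<^esub> ?B"] by (simp add: unitors)
  also have "\<dots> = ecomp S X Q Y \<cdot>\<^bsub>V\<^esub> (\<one>\<^bsub>V\<^esub> ?A \<boxtimes>\<^bsub>V\<^esub> far (enr S) (\<one>\<^bsub>S\<^esub> X, f))"
    by (simp add: enr_covariant_arr V.interchange)
  finally show ?thesis .
qed

text \<open>Precomposition with a right unitor cancels the inverse unitor that
  \<open>enr_contravariant\<close> introduces; \<open>ecomp_assoc\<close> then moves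
  \<open>ephi S v\<close> into the right factor, and \<open>runit_tensor\<close> identifies the
  leftover unitor with that of the tensor product.\<close>

lemma ecomp_natural_left:
  assumes v: "v \<in> hom S X X'" and [simp]: "P \<in> obj S" "Y \<in> obj S"
  shows "far (enr S) (v, \<one>\<^bsub>S\<^esub> Y) \<cdot>\<^bsub>V\<^esub> ecomp S X' P Y =
    ecomp S X P Y \<cdot>\<^bsub>V\<^esub> (\<one>\<^bsub>V\<^esub> (enr_obj S P Y) \<boxtimes>\<^bsub>V\<^esub> far (enr S) (v, \<one>\<^bsub>S\<^esub> P))"
proof (rule V.isos_cancel_right [OF V.runit_iso])
  note [simp] = S.homD [OF v]
  let ?A = "enr_obj S P Y" and ?B = "enr_obj S X' P" and ?I = "unit V"
  let ?p = "ephi S v" and ?m = "ecomp S X' P Y"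
  have "(far (enr S) (v, \<one>\<^bsub>S\<^esub> Y) \<cdot>\<^bsub>V\<^esub> ?m) \<cdot>\<^bsub>V\<^esub> runit V (?A \<otimes>\<^bsub>V\<^esub> ?B) =
      far (enr S) (v, \<one>\<^bsub>S\<^esub> Y) \<cdot>\<^bsub>V\<^esub> (runit V (enr_obj S X' Y) \<cdot>\<^bsub>V\<^esub> (?m \<boxtimes>\<^bsub>V\<^esub> \<one>\<^bsub>V\<^esub> ?I))"
    by (simp add: V.runit_natural [OF ecomp_hom])
  \<comment> \<open>Naturality of \<open>runit\<close> has brought the unitor next to its inverse;
    the pair is bracketed off so that the next step can cancel it.\<close>
  also have "\<dots> = ecomp S X X' Y \<cdot>\<^bsub>V\<^esub> ((\<one>\<^bsub>V\<^esub> (enr_obj S X' Y) \<boxtimes>\<^bsub>V\<^esub> ?p) \<cdot>\<^bsub>V\<^esub>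
      ((inv_arr V (runit V (enr_obj S X' Y)) \<cdot>\<^bsub>V\<^esub> runit V (enr_obj S X' Y)) \<cdot>\<^bsub>V\<^esub> (?m \<boxtimes>\<^bsub>V\<^esub> \<one>\<^bsub>V\<^esub> ?I)))"
    by (simp add: enr_contravariant_arr del: V.runit_arr(7))
  also have "\<dots> = (ecomp S X X' Y \<cdot>\<^bsub>V\<^esub> (?m \<boxtimes>\<^bsub>V\<^esub> \<one>\<^bsub>V\<^esub> (enr_obj S X X'))) \<cdot>\<^bsub>V\<^esub>
      ((\<one>\<^bsub>V\<^esub> ?A \<boxtimes>\<^bsub>V\<^esub> \<one>\<^bsub>V\<^esub> ?B) \<boxtimes>\<^bsub>V\<^esub> ?p)"
    by (simp add: V.interchange V.tensor_ide)
  also have "\<dots> = ecomp S X P Y \<cdot>\<^bsub>V\<^esub> (\<one>\<^bsub>V\<^esub> ?A \<boxtimes>\<^bsub>V\<^esub> ecomp S X X' P) \<cdot>\<^bsub>V\<^esub>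
      (assoc V ?A ?B (enr_obj S X X') \<cdot>\<^bsub>V\<^esub> ((\<one>\<^bsub>V\<^esub> ?A \<boxtimes>\<^bsub>V\<^esub> \<one>\<^bsub>V\<^esub> ?B) \<boxtimes>\<^bsub>V\<^esub> ?p))"
    by (subst ecomp_assoc) simp_all
  also have "\<dots> = ecomp S X P Y \<cdot>\<^bsub>V\<^esub> (\<one>\<^bsub>V\<^esub> ?A \<boxtimes>\<^bsub>V\<^esub> (ecomp S X X' P \<cdot>\<^bsub>V\<^esub> (\<one>\<^bsub>V\<^esub> ?B \<boxtimes>\<^bsub>V\<^esub> ?p))) \<cdot>\<^bsub>V\<^esub> assoc V ?A ?B ?I"
    using V.assoc_natural_arr [of "\<one>\<^bsub>V\<^esub> ?A" "\<one>\<^bsub>V\<^esub> ?B" ?p] by (simp add: V.interchange_assoc)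
  also have "\<dots> = ecomp S X P Y \<cdot>\<^bsub>V\<^esub> (\<one>\<^bsub>V\<^esub> ?A \<boxtimes>\<^bsub>V\<^esub> (far (enr S) (v, \<one>\<^bsub>S\<^esub> P) \<cdot>\<^bsub>V\<^esub> runit V ?B)) \<cdot>\<^bsub>V\<^esub> assoc V ?A ?B ?I"
    by (simp add: enr_contravariant_arr)
  also have "\<dots> = (ecomp S X P Y \<cdot>\<^bsub>V\<^esub> (\<one>\<^bsub>V\<^esub> ?A \<boxtimes>\<^bsub>V\<^esub> far (enr S) (v, \<one>\<^bsub>S\<^esub> P))) \<cdot>\<^bsub>V\<^esub> runit V (?A \<otimes>\<^bsub>V\<^esub> ?B)"
    by (simp add: V.runit_tensor V.interchange_assoc)
  finally show "(far (enr S) (v, \<one>\<^bsub>S\<^esub> Y) \<cdot>\<^bsub>V\<^esub> ?m) \<cdot>\<^bsub>V\<^esub> runit V (?A \<otimes>\<^bsub>V\<^esub> ?B) =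
    (ecomp S X P Y \<cdot>\<^bsub>V\<^esub> (\<one>\<^bsub>V\<^esub> ?A \<boxtimes>\<^bsub>V\<^esub> far (enr S) (v, \<one>\<^bsub>S\<^esub> P))) \<cdot>\<^bsub>V\<^esub> runit V (?A \<otimes>\<^bsub>V\<^esub> ?B)" .
qed (use S.homD [OF v] in \<open>auto intro!: V.homI\<close>)

text \<open>The mirror image of \<open>ecomp_natural_left\<close> with left unitors. In
  \<open>lunit_tensor\<close> the unitor of the tensor product comes with an associator, which is
  why an associator is cancelled as well.\<close>

lemma ecomp_natural_right:
  assumes w: "w \<in> hom S Y Y'" and [simp]: "X \<in> obj S" "P \<in> obj S"
  shows "far (enr S) (\<one>\<^bsub>S\<^esub> X, w) \<cdot>\<^bsub>V\<^esub> ecomp S X P Y =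
    ecomp S X P Y' \<cdot>\<^bsub>V\<^esub> (far (enr S) (\<one>\<^bsub>S\<^esub> P, w) \<boxtimes>\<^bsub>V\<^esub> \<one>\<^bsub>V\<^esub> (enr_obj S X P))"
proof (rule V.isos_cancel_right [OF V.lunit_iso])
  note [simp] = S.homD [OF w]
  let ?A = "enr_obj S P Y" and ?B = "enr_obj S X P" and ?I = "unit V"
  let ?p = "ephi S w" and ?m = "ecomp S X P Y"
  show "(far (enr S) (\<one>\<^bsub>S\<^esub> X, w) \<cdot>\<^bsub>V\<^esub> ?m) \<cdot>\<^bsub>V\<^esub> lunit V (?A \<otimes>\<^bsub>V\<^esub> ?B) =
    (ecomp S X P Y' \<cdot>\<^bsub>V\<^esub> (far (enr S) (\<one>\<^bsub>S\<^esub> P, w) \<boxtimes>\<^bsub>V\<^esub> \<one>\<^bsub>V\<^esub> ?B)) \<cdot>\<^bsub>V\<^esub> lunit V (?A \<otimes>\<^bsub>V\<^esub> ?B)"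
  proof (rule V.isos_cancel_right [OF V.assoc_iso [of ?I ?A ?B]])
    have "(far (enr S) (\<one>\<^bsub>S\<^esub> X, w) \<cdot>\<^bsub>V\<^esub> ?m) \<cdot>\<^bsub>V\<^esub> lunit V (?A \<otimes>\<^bsub>V\<^esub> ?B) \<cdot>\<^bsub>V\<^esub> assoc V ?I ?A ?B =
        far (enr S) (\<one>\<^bsub>S\<^esub> X, w) \<cdot>\<^bsub>V\<^esub> (?m \<cdot>\<^bsub>V\<^esub> lunit V (?A \<otimes>\<^bsub>V\<^esub> ?B)) \<cdot>\<^bsub>V\<^esub> assoc V ?I ?A ?B"
      by simp
    also have "\<dots> = far (enr S) (\<one>\<^bsub>S\<^esub> X, w) \<cdot>\<^bsub>V\<^esub> (lunit V (enr_obj S X Y) \<cdot>\<^bsub>V\<^esub> (\<one>\<^bsub>V\<^esub> ?I \<boxtimes>\<^bsub>V\<^esub> ?m)) \<cdot>\<^bsub>V\<^esub> assoc V ?I ?A ?B"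
      by (simp only: V.lunit_natural [OF ecomp_hom] assms \<open>Y \<in> obj S\<close>)
    also have "\<dots> = ecomp S X Y Y' \<cdot>\<^bsub>V\<^esub> ((?p \<boxtimes>\<^bsub>V\<^esub> \<one>\<^bsub>V\<^esub> (enr_obj S X Y)) \<cdot>\<^bsub>V\<^esub>
        ((inv_arr V (lunit V (enr_obj S X Y)) \<cdot>\<^bsub>V\<^esub> lunit V (enr_obj S X Y)) \<cdot>\<^bsub>V\<^esub> (\<one>\<^bsub>V\<^esub> ?I \<boxtimes>\<^bsub>V\<^esub> ?m)) \<cdot>\<^bsub>V\<^esub> assoc V ?I ?A ?B)"
      by (simp add: enr_covariant_arr del: V.lunit_arr(7))
    also have "\<dots> = ecomp S X Y Y' \<cdot>\<^bsub>V\<^esub> (\<one>\<^bsub>V\<^esub> (enr_obj S Y Y') \<boxtimes>\<^bsub>V\<^esub> ?m) \<cdot>\<^bsub>V\<^esub>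
        ((?p \<boxtimes>\<^bsub>V\<^esub> (\<one>\<^bsub>V\<^esub> ?A \<boxtimes>\<^bsub>V\<^esub> \<one>\<^bsub>V\<^esub> ?B)) \<cdot>\<^bsub>V\<^esub> assoc V ?I ?A ?B)"
      by (simp add: V.interchange_assoc V.tensor_ide)
    also have "\<dots> = (ecomp S X Y Y' \<cdot>\<^bsub>V\<^esub> (\<one>\<^bsub>V\<^esub> (enr_obj S Y Y') \<boxtimes>\<^bsub>V\<^esub> ?m) \<cdot>\<^bsub>V\<^esub> assoc V (enr_obj S Y Y') ?A ?B) \<cdot>\<^bsub>V\<^esub>
        ((?p \<boxtimes>\<^bsub>V\<^esub> \<one>\<^bsub>V\<^esub> ?A) \<boxtimes>\<^bsub>V\<^esub> \<one>\<^bsub>V\<^esub> ?B)"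
      using V.assoc_natural_arr [of ?p "\<one>\<^bsub>V\<^esub> ?A" "\<one>\<^bsub>V\<^esub> ?B"] by simp
    also have "\<dots> = ecomp S X P Y' \<cdot>\<^bsub>V\<^esub> (ecomp S P Y Y' \<boxtimes>\<^bsub>V\<^esub> \<one>\<^bsub>V\<^esub> ?B) \<cdot>\<^bsub>V\<^esub> ((?p \<boxtimes>\<^bsub>V\<^esub> \<one>\<^bsub>V\<^esub> ?A) \<boxtimes>\<^bsub>V\<^esub> \<one>\<^bsub>V\<^esub> ?B)"
      by (subst ecomp_assoc) simp_all
    also have "\<dots> = ecomp S X P Y' \<cdot>\<^bsub>V\<^esub> ((far (enr S) (\<one>\<^bsub>S\<^esub> P, w) \<cdot>\<^bsub>V\<^esub> lunit V ?A) \<boxtimes>\<^bsub>V\<^esub> \<one>\<^bsub>V\<^esub> ?B)"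
      by (simp add: enr_covariant_arr V.interchange)
    also have "\<dots> = (ecomp S X P Y' \<cdot>\<^bsub>V\<^esub> (far (enr S) (\<one>\<^bsub>S\<^esub> P, w) \<boxtimes>\<^bsub>V\<^esub> \<one>\<^bsub>V\<^esub> ?B)) \<cdot>\<^bsub>V\<^esub> (lunit V ?A \<boxtimes>\<^bsub>V\<^esub> \<one>\<^bsub>V\<^esub> ?B)"
      by (simp add: V.interchange)
    also have "\<dots> = (ecomp S X P Y' \<cdot>\<^bsub>V\<^esub> (far (enr S) (\<one>\<^bsub>S\<^esub> P, w) \<boxtimes>\<^bsub>V\<^esub> \<one>\<^bsub>V\<^esub> ?B)) \<cdot>\<^bsub>V\<^esub>
        lunit V (?A \<otimes>\<^bsub>V\<^esub> ?B) \<cdot>\<^bsub>V\<^esub> assoc V ?I ?A ?B"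
      by (simp add: V.lunit_tensor)
    finally show "(far (enr S) (\<one>\<^bsub>S\<^esub> X, w) \<cdot>\<^bsub>V\<^esub> ?m) \<cdot>\<^bsub>V\<^esub> lunit V (?A \<otimes>\<^bsub>V\<^esub> ?B) \<cdot>\<^bsub>V\<^esub> assoc V ?I ?A ?B =
      (ecomp S X P Y' \<cdot>\<^bsub>V\<^esub> (far (enr S) (\<one>\<^bsub>S\<^esub> P, w) \<boxtimes>\<^bsub>V\<^esub> \<one>\<^bsub>V\<^esub> ?B)) \<cdot>\<^bsub>V\<^esub>
        lunit V (?A \<otimes>\<^bsub>V\<^esub> ?B) \<cdot>\<^bsub>V\<^esub> assoc V ?I ?A ?B" .
  qed (auto intro!: V.homI)
qed (use S.homD [OF w] in \<open>auto intro!: V.homI\<close>)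

end

section \<open>Cylinders: universality of \<alpha> and naturality of \<phi>\<close>

locale cylinder = category_with_structure V S
  for V :: "('o, 'a, 'x) closed_monoidal_data_scheme"
    and S :: "('p, 'b, 'o, 'a, 'y) enriched_data_scheme" +
  fixes K X P \<alpha> \<phi>
  assumes K [simp]: "K \<in> obj V" and X [simp]: "X \<in> obj S"
    and cylinder: "is_cylinder V S K X P \<alpha> \<phi>"
begin

lemma P [simp]: "P \<in> obj S"
  using cylinder by (simp add: is_cylinder_def)

lemma \<alpha>_arr [simp]: "\<alpha> \<in> arr V" "src V \<alpha> = K" "tgt V \<alpha> = enr_obj S X P"
  using cylinder by (auto simp: is_cylinder_def hom_def)

lemma \<phi>_iso: "Y \<in> obj S \<Longrightarrow> \<phi> Y \<in> isos V (enr_obj S P Y) (ihom_obj V K (enr_obj S X Y))"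
  using cylinder by (simp add: is_cylinder_def)

lemmas \<phi>_arr [simp] = V.isos_arr [OF \<phi>_iso] V.inv_arr_arr [OF \<phi>_iso]

lemma counit_\<phi>:
  "Y \<in> obj S \<Longrightarrow> counit V K (enr_obj S X Y) \<cdot>\<^bsub>V\<^esub> (\<phi> Y \<boxtimes>\<^bsub>V\<^esub> \<one>\<^bsub>V\<^esub> K) =
    ecomp S X P Y \<cdot>\<^bsub>V\<^esub> (\<one>\<^bsub>V\<^esub> (enr_obj S P Y) \<boxtimes>\<^bsub>V\<^esub> \<alpha>)"
  using cylinder by (simp add: is_cylinder_def)

text \<open>The cylinder equation precomposed with \<open>g \<boxtimes> \<one> K\<close>; it
  evaluates any arrow that factors through \<open>\<phi> Y\<close>.\<close>

lemma counit_\<phi>_cmp: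
  assumes [simp]: "Y \<in> obj S" "g \<in> arr V" and g: "tgt V g = enr_obj S P Y"
  shows "counit V K (enr_obj S X Y) \<cdot>\<^bsub>V\<^esub> ((\<phi> Y \<cdot>\<^bsub>V\<^esub> g) \<boxtimes>\<^bsub>V\<^esub> \<one>\<^bsub>V\<^esub> K) = ecomp S X P Y \<cdot>\<^bsub>V\<^esub> (g \<boxtimes>\<^bsub>V\<^esub> \<alpha>)"
proof -
  have "counit V K (enr_obj S X Y) \<cdot>\<^bsub>V\<^esub> ((\<phi> Y \<cdot>\<^bsub>V\<^esub> g) \<boxtimes>\<^bsub>V\<^esub> \<one>\<^bsub>V\<^esub> K) =
      (counit V K (enr_obj S X Y) \<cdot>\<^bsub>V\<^esub> (\<phi> Y \<boxtimes>\<^bsub>V\<^esub> \<one>\<^bsub>V\<^esub> K)) \<cdot>\<^bsub>V\<^esub> (g \<boxtimes>\<^bsub>V\<^esub> \<one>\<^bsub>V\<^esub> K)"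
    using g by (simp add: V.interchange)
  also have "\<dots> = ecomp S X P Y \<cdot>\<^bsub>V\<^esub> (g \<boxtimes>\<^bsub>V\<^esub> \<alpha>)"
    using g by (subst counit_\<phi>) (simp_all add: V.interchange)
  finally show ?thesis .
qed

text \<open>Expanding by \<open>enr_covariant\<close> and cancelling unitors leaves composition
  applied to \<open>ephi S f \<boxtimes> \<alpha>\<close>, which the cylinder equation rewrites. So
  \<open>f\<close> and its composite with \<alpha> correspond through the bijections given by
  \<open>ephi S\<close>, \<open>\<phi> Y\<close>, transposition and \<open>lunit\<close>.\<close>

lemma enr_cmp_\<alpha>:
  assumes f: "f \<in> hom S P Y"
  shows "(far (enr S) (\<one>\<^bsub>S\<^esub> X, f) \<cdot>\<^bsub>V\<^esub> \<alpha>) \<cdot>\<^bsub>V\<^esub> lunit V K =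
    counit V K (enr_obj S X Y) \<cdot>\<^bsub>V\<^esub> ((\<phi> Y \<cdot>\<^bsub>V\<^esub> ephi S f) \<boxtimes>\<^bsub>V\<^esub> \<one>\<^bsub>V\<^esub> K)"
proof -
  note [simp] = S.homD [OF f]
  let ?B = "enr_obj S X P"
  have "(far (enr S) (\<one>\<^bsub>S\<^esub> X, f) \<cdot>\<^bsub>V\<^esub> \<alpha>) \<cdot>\<^bsub>V\<^esub> lunit V K =
      far (enr S) (\<one>\<^bsub>S\<^esub> X, f) \<cdot>\<^bsub>V\<^esub> (lunit V ?B \<cdot>\<^bsub>V\<^esub> (\<one>\<^bsub>V\<^esub> (unit V) \<boxtimes>\<^bsub>V\<^esub> \<alpha>))"
    by (simp add: V.lunit_natural [of \<alpha> K] V.homI)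
  also have "\<dots> = ecomp S X P Y \<cdot>\<^bsub>V\<^esub> ((ephi S f \<boxtimes>\<^bsub>V\<^esub> \<one>\<^bsub>V\<^esub> ?B) \<cdot>\<^bsub>V\<^esub>
      ((inv_arr V (lunit V ?B) \<cdot>\<^bsub>V\<^esub> lunit V ?B) \<cdot>\<^bsub>V\<^esub> (\<one>\<^bsub>V\<^esub> (unit V) \<boxtimes>\<^bsub>V\<^esub> \<alpha>)))"
    by (simp add: enr_covariant_arr del: V.lunit_arr(7))
  also have "\<dots> = ecomp S X P Y \<cdot>\<^bsub>V\<^esub> (ephi S f \<boxtimes>\<^bsub>V\<^esub> \<alpha>)"
    by (simp add: V.interchange)
  finally show ?thesis
    by (simp add: counit_\<phi>_cmp)
qed

lemma \<alpha>_universal: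
  assumes k: "k \<in> hom V K (enr_obj S X Y)" and [simp]: "Y \<in> obj S"
  shows "\<exists>!f. f \<in> hom S P Y \<and> far (enr S) (\<one>\<^bsub>S\<^esub> X, f) \<cdot>\<^bsub>V\<^esub> \<alpha> = k"
proof (rule ex_ex1I)
  note [simp] = V.homD [OF k]
  have kl: "k \<cdot>\<^bsub>V\<^esub> lunit V K \<in> hom V (unit V \<otimes>\<^bsub>V\<^esub> K) (enr_obj S X Y)"
    by (simp add: V.homI)
  \<comment> \<open>Runs the bijections behind \<open>enr_cmp_\<alpha>\<close> backwards from
    \<open>k\<close>: precompose with the unitor, transpose, undo \<open>\<phi> Y\<close>.
    Surjectivity of \<open>ephi S\<close> then supplies \<open>f\<close>.\<close>
  define g where "g = inv_arr V (\<phi> Y) \<cdot>\<^bsub>V\<^esub> adj V (unit V) K (enr_obj S X Y) (k \<cdot>\<^bsub>V\<^esub> lunit V K)"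
  note [simp] = V.homD [OF V.adj_arr [OF V.unit_obj K kl]]
  have "g \<in> hom V (unit V) (enr_obj S P Y)"
    by (simp add: g_def V.homI)
  then obtain f where f: "f \<in> hom S P Y" "g = ephi S f"
    using ephi_bij [of P Y] by (auto simp: bij_betw_def)
  note [simp] = S.homD [OF f(1)]
  have "\<phi> Y \<cdot>\<^bsub>V\<^esub> ephi S f = (\<phi> Y \<cdot>\<^bsub>V\<^esub> inv_arr V (\<phi> Y)) \<cdot>\<^bsub>V\<^esub> adj V (unit V) K (enr_obj S X Y) (k \<cdot>\<^bsub>V\<^esub> lunit V K)"
    by (simp flip: f(2) add: g_def del: \<phi>_arr(8))
  then have "(far (enr S) (\<one>\<^bsub>S\<^esub> X, f) \<cdot>\<^bsub>V\<^esub> \<alpha>) \<cdot>\<^bsub>V\<^esub> lunit V K = k \<cdot>\<^bsub>V\<^esub> lunit V K"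
    by (simp add: enr_cmp_\<alpha> [OF f(1)] V.counit_adj [OF _ _ kl] del: V.cmp_assoc_arr)
  then have "far (enr S) (\<one>\<^bsub>S\<^esub> X, f) \<cdot>\<^bsub>V\<^esub> \<alpha> = k"
    by (rule V.isos_cancel_right [OF V.lunit_iso, rotated -1]) (auto intro!: V.homI)
  with f show "\<exists>f. f \<in> hom S P Y \<and> far (enr S) (\<one>\<^bsub>S\<^esub> X, f) \<cdot>\<^bsub>V\<^esub> \<alpha> = k"
    by blast
next
  fix f g
  assume "f \<in> hom S P Y \<and> far (enr S) (\<one>\<^bsub>S\<^esub> X, f) \<cdot>\<^bsub>V\<^esub> \<alpha> = k"
    and "g \<in> hom S P Y \<and> far (enr S) (\<one>\<^bsub>S\<^esub> X, g) \<cdot>\<^bsub>V\<^esub> \<alpha> = k"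
  then have f: "f \<in> hom S P Y" and g: "g \<in> hom S P Y"
    and eq: "far (enr S) (\<one>\<^bsub>S\<^esub> X, f) \<cdot>\<^bsub>V\<^esub> \<alpha> = far (enr S) (\<one>\<^bsub>S\<^esub> X, g) \<cdot>\<^bsub>V\<^esub> \<alpha>"
    by auto
  note [simp] = S.homD [OF f] S.homD [OF g]
  \<comment> \<open>\<open>enr_cmp_\<alpha>\<close> turns equality of the composites with \<alpha>
    into equality of evaluations, from which the bijections are stripped one at a time: evaluation,
    \<open>\<phi> Y\<close>, \<open>ephi S\<close>.\<close>
  have "\<phi> Y \<cdot>\<^bsub>V\<^esub> ephi S f = \<phi> Y \<cdot>\<^bsub>V\<^esub> ephi S g"
    by (rule V.counit_tensor_inj [of K "enr_obj S X Y" _ "unit V"])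
      (auto intro!: V.homI simp flip: enr_cmp_\<alpha> [OF f] enr_cmp_\<alpha> [OF g] simp: eq)
  then have "ephi S f = ephi S g"
    by (rule V.isos_cancel_left [OF \<phi>_iso, rotated -1]) (auto intro!: V.homI)
  then show "f = g"
    using ephi_bij [of P Y] f g by (auto simp: bij_betw_def dest: inj_onD)
qed

text \<open>After evaluation, \<open>counit_natural\<close> brings the action of \<open>w\<close>
  outside composition, and \<open>ecomp_natural_right\<close> carries it to the left factor, where
  the cylinder equation for \<open>Y'\<close> absorbs it.\<close>

lemma \<phi>_natural:
  assumes w: "w \<in> hom S Y Y'"
  shows "far (ihom V) (\<one>\<^bsub>V\<^esub> K, far (enr S) (\<one>\<^bsub>S\<^esub> X, w)) \<cdot>\<^bsub>V\<^esub> \<phi> Y =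
    \<phi> Y' \<cdot>\<^bsub>V\<^esub> far (enr S) (\<one>\<^bsub>S\<^esub> P, w)"
proof (rule V.counit_tensor_inj [of K "enr_obj S X Y'" _ "enr_obj S P Y"])
  note [simp] = S.homD [OF w]
  let ?w = "far (enr S) (\<one>\<^bsub>S\<^esub> X, w)"
  have w': "?w \<in> hom V (enr_obj S X Y) (enr_obj S X Y')"
    by (simp add: V.homI)
  have "counit V K (enr_obj S X Y') \<cdot>\<^bsub>V\<^esub> ((far (ihom V) (\<one>\<^bsub>V\<^esub> K, ?w) \<cdot>\<^bsub>V\<^esub> \<phi> Y) \<boxtimes>\<^bsub>V\<^esub> \<one>\<^bsub>V\<^esub> K) =
      (counit V K (enr_obj S X Y') \<cdot>\<^bsub>V\<^esub> (far (ihom V) (\<one>\<^bsub>V\<^esub> K, ?w) \<boxtimes>\<^bsub>V\<^esub> \<one>\<^bsub>V\<^esub> K)) \<cdot>\<^bsub>V\<^esub> (\<phi> Y \<boxtimes>\<^bsub>V\<^esub> \<one>\<^bsub>V\<^esub> K)"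
    by (simp add: V.interchange)
  also have "\<dots> = (?w \<cdot>\<^bsub>V\<^esub> ecomp S X P Y) \<cdot>\<^bsub>V\<^esub> (\<one>\<^bsub>V\<^esub> (enr_obj S P Y) \<boxtimes>\<^bsub>V\<^esub> \<alpha>)"
    by (simp add: V.counit_natural [OF V.ide_hom [OF K] w'] counit_\<phi> V.tensor_ide)
  also have "\<dots> = ecomp S X P Y' \<cdot>\<^bsub>V\<^esub> (far (enr S) (\<one>\<^bsub>S\<^esub> P, w) \<boxtimes>\<^bsub>V\<^esub> \<alpha>)"
    by (subst ecomp_natural_right [OF w]) (simp_all add: V.interchange)
  also have "\<dots> = counit V K (enr_obj S X Y') \<cdot>\<^bsub>V\<^esub> ((\<phi> Y' \<cdot>\<^bsub>V\<^esub> far (enr S) (\<one>\<^bsub>S\<^esub> P, w)) \<boxtimes>\<^bsub>V\<^esub> \<one>\<^bsub>V\<^esub> K)"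
    by (simp add: counit_\<phi>_cmp)
  finally show "counit V K (enr_obj S X Y') \<cdot>\<^bsub>V\<^esub> ((far (ihom V) (\<one>\<^bsub>V\<^esub> K, ?w) \<cdot>\<^bsub>V\<^esub> \<phi> Y) \<boxtimes>\<^bsub>V\<^esub> \<one>\<^bsub>V\<^esub> K) =
    counit V K (enr_obj S X Y') \<cdot>\<^bsub>V\<^esub> ((\<phi> Y' \<cdot>\<^bsub>V\<^esub> far (enr S) (\<one>\<^bsub>S\<^esub> P, w)) \<boxtimes>\<^bsub>V\<^esub> \<one>\<^bsub>V\<^esub> K)" .
qed (use S.homD [OF w] in \<open>auto intro!: V.homI\<close>)

end

text \<open>Serves naturality in \<open>K\<close> and \<open>X\<close> simultaneously, with
  \<open>t\<close> in the role of \<open>u \<otimes> v\<close>. Evaluation collects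
  \<open>v\<close>, \<beta> and \<open>u\<close> in the right tensor factor, by
  \<open>counit_natural\<close> and \<open>ecomp_natural_left\<close>; \<open>eq\<close> exchanges
  them for \<open>t\<close> and \<alpha>, and \<open>ecomp_extranatural\<close> moves
  \<open>t\<close> to the left factor, where it acts contravariantly.\<close>

lemma cylinder_transformation:
  assumes "cylinder V S K X P \<alpha> \<phi>" "cylinder V S L X' Q \<beta> \<psi>"
    and u: "u \<in> hom V K L" and v: "v \<in> hom S X X'" and t: "t \<in> hom S P Q" and Y [simp]: "Y \<in> obj S"
    and eq: "far (enr S) (\<one>\<^bsub>S\<^esub> X, t) \<cdot>\<^bsub>V\<^esub> \<alpha> = far (enr S) (v, \<one>\<^bsub>S\<^esub> Q) \<cdot>\<^bsub>V\<^esub> (\<beta> \<cdot>\<^bsub>V\<^esub> u)"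
  shows "far (ihom V) (u, far (enr S) (v, \<one>\<^bsub>S\<^esub> Y)) \<cdot>\<^bsub>V\<^esub> \<psi> Y =
    \<phi> Y \<cdot>\<^bsub>V\<^esub> far (enr S) (t, \<one>\<^bsub>S\<^esub> Y)"
proof -
  interpret A: cylinder V S K X P \<alpha> \<phi> by fact
  interpret B: cylinder V S L X' Q \<beta> \<psi> by fact
  note [simp] = A.V.homD [OF u] A.S.homD [OF v] A.S.homD [OF t]
  let ?v = "far (enr S) (v, \<one>\<^bsub>S\<^esub> Y)" and ?Q = "enr_obj S Q Y" and ?\<epsilon> = "counit V K (enr_obj S X Y)"
  have v': "?v \<in> hom V (enr_obj S X' Y) (enr_obj S X Y)"
    by (simp add: A.V.homI)
  show ?thesis
  proof (rule A.V.counit_tensor_inj [of K "enr_obj S X Y" _ ?Q])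
    have "?\<epsilon> \<cdot>\<^bsub>V\<^esub> ((far (ihom V) (u, ?v) \<cdot>\<^bsub>V\<^esub> \<psi> Y) \<boxtimes>\<^bsub>V\<^esub> \<one>\<^bsub>V\<^esub> K) =
        (?\<epsilon> \<cdot>\<^bsub>V\<^esub> (far (ihom V) (u, ?v) \<boxtimes>\<^bsub>V\<^esub> \<one>\<^bsub>V\<^esub> K)) \<cdot>\<^bsub>V\<^esub> (\<psi> Y \<boxtimes>\<^bsub>V\<^esub> \<one>\<^bsub>V\<^esub> K)"
      by (simp add: A.V.interchange)
    \<comment> \<open>\<open>counit_natural\<close> trades the action of \<open>u\<close> on the
      internal hom for \<open>u\<close> on the evaluated factor, so evaluation is now at
      \<open>L\<close> and the cylinder equation for \<psi> applies.\<close>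
    also have "\<dots> = ?v \<cdot>\<^bsub>V\<^esub> (counit V L (enr_obj S X' Y) \<cdot>\<^bsub>V\<^esub> (\<psi> Y \<boxtimes>\<^bsub>V\<^esub> \<one>\<^bsub>V\<^esub> L)) \<cdot>\<^bsub>V\<^esub> (\<one>\<^bsub>V\<^esub> ?Q \<boxtimes>\<^bsub>V\<^esub> u)"
      by (simp add: A.V.counit_natural [OF u v'] A.V.interchange)
    also have "\<dots> = (?v \<cdot>\<^bsub>V\<^esub> ecomp S X' Q Y) \<cdot>\<^bsub>V\<^esub> (\<one>\<^bsub>V\<^esub> ?Q \<boxtimes>\<^bsub>V\<^esub> (\<beta> \<cdot>\<^bsub>V\<^esub> u))"
      by (simp add: B.counit_\<phi> A.V.interchange)
    also have "\<dots> = ecomp S X Q Y \<cdot>\<^bsub>V\<^esub> (\<one>\<^bsub>V\<^esub> ?Q \<boxtimes>\<^bsub>V\<^esub> (far (enr S) (\<one>\<^bsub>S\<^esub> X, t) \<cdot>\<^bsub>V\<^esub> \<alpha>))"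
      by (subst A.ecomp_natural_left [OF v]) (simp_all add: A.V.interchange eq)
    also have "\<dots> = (ecomp S X Q Y \<cdot>\<^bsub>V\<^esub> (\<one>\<^bsub>V\<^esub> ?Q \<boxtimes>\<^bsub>V\<^esub> far (enr S) (\<one>\<^bsub>S\<^esub> X, t))) \<cdot>\<^bsub>V\<^esub> (\<one>\<^bsub>V\<^esub> ?Q \<boxtimes>\<^bsub>V\<^esub> \<alpha>)"
      by (simp add: A.V.interchange)
    also have "\<dots> = ecomp S X P Y \<cdot>\<^bsub>V\<^esub> (far (enr S) (t, \<one>\<^bsub>S\<^esub> Y) \<boxtimes>\<^bsub>V\<^esub> \<alpha>)"
      by (subst A.ecomp_extranatural [OF t, symmetric]) (simp_all add: A.V.interchange)
    also have "\<dots> = ?\<epsilon> \<cdot>\<^bsub>V\<^esub> ((\<phi> Y \<cdot>\<^bsub>V\<^esub> far (enr S) (t, \<one>\<^bsub>S\<^esub> Y)) \<boxtimes>\<^bsub>V\<^esub> \<one>\<^bsub>V\<^esub> K)"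
      by (simp add: A.counit_\<phi>_cmp)
    finally show "?\<epsilon> \<cdot>\<^bsub>V\<^esub> ((far (ihom V) (u, ?v) \<cdot>\<^bsub>V\<^esub> \<psi> Y) \<boxtimes>\<^bsub>V\<^esub> \<one>\<^bsub>V\<^esub> K) =
      ?\<epsilon> \<cdot>\<^bsub>V\<^esub> ((\<phi> Y \<cdot>\<^bsub>V\<^esub> far (enr S) (t, \<one>\<^bsub>S\<^esub> Y)) \<boxtimes>\<^bsub>V\<^esub> \<one>\<^bsub>V\<^esub> K)" .
  qed (auto intro!: A.V.homI)
qed

section \<open>The bifunctor built from the chosen cylinders\<close>

locale cylinder_choice = category_with_structure V S
  for V :: "('o, 'a, 'x) closed_monoidal_data_scheme"
    and S :: "('p, 'b, 'o, 'a, 'y) enriched_data_scheme" +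
  fixes cyl :: "'o \<Rightarrow> 'p \<Rightarrow> 'p"
    and \<alpha> :: "'o \<Rightarrow> 'p \<Rightarrow> 'a"
    and \<phi> :: "'o \<Rightarrow> 'p \<Rightarrow> 'p \<Rightarrow> 'a"
  assumes is_cyl: "K \<in> obj V \<Longrightarrow> X \<in> obj S \<Longrightarrow> is_cylinder V S K X (cyl K X) (\<alpha> K X) (\<phi> K X)"
begin

lemma cyl: "K \<in> obj V \<Longrightarrow> X \<in> obj S \<Longrightarrow> cylinder V S K X (cyl K X) (\<alpha> K X) (\<phi> K X)"
  by unfold_locales (auto intro: is_cyl)

lemmas cyl_obj [simp] = cylinder.P [OF cyl]
lemmas \<alpha>_arr [simp] = cylinder.\<alpha>_arr [OF cyl]

text \<open>The condition that characterises \<open>u \<otimes> v\<close>: both requirements on the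
  bifunctor merged into one equation. Taking \<open>v\<close> or \<open>u\<close> to be an identity
  gives them back.\<close>

definition is_cyl_arr :: "'a \<Rightarrow> 'b \<Rightarrow> 'b \<Rightarrow> bool" where
  "is_cyl_arr u v t \<longleftrightarrow> t \<in> hom S (cyl (src V u) (src S v)) (cyl (tgt V u) (tgt S v)) \<and>
    far (enr S) (\<one>\<^bsub>S\<^esub> (src S v), t) \<cdot>\<^bsub>V\<^esub> \<alpha> (src V u) (src S v) =
    far (enr S) (v, \<one>\<^bsub>S\<^esub> (cyl (tgt V u) (tgt S v))) \<cdot>\<^bsub>V\<^esub> (\<alpha> (tgt V u) (tgt S v) \<cdot>\<^bsub>V\<^esub> u)"

text \<open>The right-hand side of the defining equation does not mention \<open>t\<close>, so this
  is universality of \<alpha> with that side as \<open>k\<close>.\<close>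

lemma ex1_cyl_arr:
  assumes "u \<in> arr V" "v \<in> arr S"
  shows "\<exists>!t. is_cyl_arr u v t"
  unfolding is_cyl_arr_def using assms
  by (intro cylinder.\<alpha>_universal [OF cyl]) (auto intro!: V.homI)

lemma is_cyl_arr_unique:
  "u \<in> arr V \<Longrightarrow> v \<in> arr S \<Longrightarrow> is_cyl_arr u v t \<Longrightarrow> is_cyl_arr u v t' \<Longrightarrow> t = t'"
  using ex1_cyl_arr by blast

lemma is_cyl_arr_ide:
  assumes [simp]: "K \<in> obj V" "X \<in> obj S"
  shows "is_cyl_arr (\<one>\<^bsub>V\<^esub> K) (\<one>\<^bsub>S\<^esub> X) (\<one>\<^bsub>S\<^esub> (cyl K X))"
  by (simp add: is_cyl_arr_def S.homI)

text \<open>The two squares are pasted along \<open>\<alpha> (tgt V u) (tgt S v)\<close>; the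
  contravariant action of \<open>v\<close> commutes with the covariant action of \<open>t'\<close>
  because \<open>enr S\<close> is a bifunctor.\<close>

lemma is_cyl_arr_cmp:
  assumes u: "u \<in> arr V" "u' \<in> arr V" "src V u' = tgt V u"
    and v: "v \<in> arr S" "v' \<in> arr S" "src S v' = tgt S v"
    and t: "is_cyl_arr u v t" and t': "is_cyl_arr u' v' t'"
  shows "is_cyl_arr (u' \<cdot>\<^bsub>V\<^esub> u) (v' \<cdot>\<^bsub>S\<^esub> v) (t' \<cdot>\<^bsub>S\<^esub> t)"
proof -
  note [simp] = u v
  let ?K = "src V u" and ?L = "tgt V u" and ?M = "tgt V u'"
    and ?X = "src S v" and ?Y = "tgt S v" and ?Z = "tgt S v'"
  from t have tD: "t \<in> hom S (cyl ?K ?X) (cyl ?L ?Y)"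
    and t_eq: "far (enr S) (\<one>\<^bsub>S\<^esub> ?X, t) \<cdot>\<^bsub>V\<^esub> \<alpha> ?K ?X =
      far (enr S) (v, \<one>\<^bsub>S\<^esub> (cyl ?L ?Y)) \<cdot>\<^bsub>V\<^esub> (\<alpha> ?L ?Y \<cdot>\<^bsub>V\<^esub> u)"
    by (auto simp: is_cyl_arr_def)
  from t' have t'D: "t' \<in> hom S (cyl ?L ?Y) (cyl ?M ?Z)"
    and t'_eq: "far (enr S) (\<one>\<^bsub>S\<^esub> ?Y, t') \<cdot>\<^bsub>V\<^esub> \<alpha> ?L ?Y =
      far (enr S) (v', \<one>\<^bsub>S\<^esub> (cyl ?M ?Z)) \<cdot>\<^bsub>V\<^esub> (\<alpha> ?M ?Z \<cdot>\<^bsub>V\<^esub> u')"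
    by (auto simp: is_cyl_arr_def)
  note [simp] = S.homD(1-3) [OF tD] S.homD(1-3) [OF t'D]
  have "far (enr S) (\<one>\<^bsub>S\<^esub> ?X, t' \<cdot>\<^bsub>S\<^esub> t) \<cdot>\<^bsub>V\<^esub> \<alpha> ?K ?X =
      far (enr S) (\<one>\<^bsub>S\<^esub> ?X, t') \<cdot>\<^bsub>V\<^esub> (far (enr S) (\<one>\<^bsub>S\<^esub> ?X, t) \<cdot>\<^bsub>V\<^esub> \<alpha> ?K ?X)"
    by (simp add: enr_cmp_assoc)
  also have "\<dots> = far (enr S) (v, \<one>\<^bsub>S\<^esub> (cyl ?M ?Z)) \<cdot>\<^bsub>V\<^esub>
      (far (enr S) (\<one>\<^bsub>S\<^esub> ?Y, t') \<cdot>\<^bsub>V\<^esub> \<alpha> ?L ?Y) \<cdot>\<^bsub>V\<^esub> u"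
    by (simp add: t_eq enr_cmp_assoc)
  also have "\<dots> = far (enr S) (v' \<cdot>\<^bsub>S\<^esub> v, \<one>\<^bsub>S\<^esub> (cyl ?M ?Z)) \<cdot>\<^bsub>V\<^esub> (\<alpha> ?M ?Z \<cdot>\<^bsub>V\<^esub> (u' \<cdot>\<^bsub>V\<^esub> u))"
    by (simp add: t'_eq enr_cmp_assoc)
  finally show ?thesis
    by (simp add: is_cyl_arr_def S.homI)
qed

text \<open>\<open>restrict\<close> makes both maps \<open>undefined\<close> off the source
  category, as \<open>is_functor\<close> requires; the definite description denotes by
  \<open>ex1_cyl_arr\<close>.\<close>

definition cyl_functor :: "('o \<times> 'p, 'a \<times> 'b, 'p, 'b) functor_data" where
  "cyl_functor = \<lparr>fob = restrict (\<lambda>(K, X). cyl K X) (obj V \<times> obj S),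
     far = restrict (\<lambda>(u, v). THE t. is_cyl_arr u v t) (arr V \<times> arr S)\<rparr>"

lemma is_cyl_arr_cyl_functor:
  assumes "u \<in> arr V" "v \<in> arr S"
  shows "is_cyl_arr u v (far cyl_functor (u, v))"
  using theI' [OF ex1_cyl_arr [OF assms]] assms by (simp add: cyl_functor_def)

text \<open>Identities and composites satisfy \<open>is_cyl_arr\<close>, so functoriality is forced
  by uniqueness.\<close>

lemma is_functor_cyl_functor: "is_functor (V \<times>\<^sub>c S) S cyl_functor"
proof -
  interpret VS: category "V \<times>\<^sub>c S"
    by (rule category_prod_cat) unfold_locales
  show ?thesis
  proof
    show "fob cyl_functor \<in> extensional (obj (V \<times>\<^sub>c S))"
      "far cyl_functor \<in> extensional (arr (V \<times>\<^sub>c S))"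
      by (simp_all add: cyl_functor_def)
    show "fob cyl_functor A \<in> obj S" if "A \<in> obj (V \<times>\<^sub>c S)" for A
      using that by (auto simp: cyl_functor_def)
    show "far cyl_functor f \<in> hom S (fob cyl_functor A) (fob cyl_functor B)"
      if "f \<in> hom (V \<times>\<^sub>c S) A B" for f A B
      using that is_cyl_arr_cyl_functor [of "fst f" "snd f"]
      by (auto simp: hom_def is_cyl_arr_def cyl_functor_def)
    show "far cyl_functor (\<one>\<^bsub>V \<times>\<^sub>c S\<^esub> A) = \<one>\<^bsub>S\<^esub> (fob cyl_functor A)" if "A \<in> obj (V \<times>\<^sub>c S)" for A
    proof -
      from that obtain K X where [simp]: "A = (K, X)" "K \<in> obj V" "X \<in> obj S"
        by auto
      have "far cyl_functor (\<one>\<^bsub>V\<^esub> K, \<one>\<^bsub>S\<^esub> X) = \<one>\<^bsub>S\<^esub> (cyl K X)"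
        by (rule is_cyl_arr_unique [OF _ _ is_cyl_arr_cyl_functor is_cyl_arr_ide]) simp_all
      then show ?thesis
        by (simp add: cyl_functor_def)
    qed
    show "far cyl_functor (g \<cdot>\<^bsub>V \<times>\<^sub>c S\<^esub> f) = far cyl_functor g \<cdot>\<^bsub>S\<^esub> far cyl_functor f"
      if "f \<in> hom (V \<times>\<^sub>c S) A B" "g \<in> hom (V \<times>\<^sub>c S) B D" for f g A B D
    proof -
      obtain u v u' v' where [simp]: "f = (u, v)" "g = (u', v')"
        by (metis prod.exhaust)
      have [simp]: "u \<in> arr V" "u' \<in> arr V" "src V u' = tgt V u"
        "v \<in> arr S" "v' \<in> arr S" "src S v' = tgt S v"
        using that by (auto simp: hom_def)
      have "far cyl_functor (u' \<cdot>\<^bsub>V\<^esub> u, v' \<cdot>\<^bsub>S\<^esub> v) = far cyl_functor (u', v') \<cdot>\<^bsub>S\<^esub> far cyl_functor (u, v)"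
        by (rule is_cyl_arr_unique [OF _ _ is_cyl_arr_cyl_functor
            is_cyl_arr_cmp [OF _ _ _ _ _ _ is_cyl_arr_cyl_functor is_cyl_arr_cyl_functor]]) simp_all
      then show ?thesis
        by simp
    qed
  qed
qed

lemma is_cyl_arr_left:
  assumes "u \<in> hom V K L" "X \<in> obj S"
  shows "is_cyl_arr u (\<one>\<^bsub>S\<^esub> X) t \<longleftrightarrow> t \<in> hom S (cyl K X) (cyl L X) \<and>
    far (enr S) (\<one>\<^bsub>S\<^esub> X, t) \<cdot>\<^bsub>V\<^esub> \<alpha> K X = \<alpha> L X \<cdot>\<^bsub>V\<^esub> u"
  using assms V.homD [OF assms(1)] by (simp add: is_cyl_arr_def enr_ide)

lemma is_cyl_arr_right:
  assumes "K \<in> obj V" "v \<in> hom S X Y"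
  shows "is_cyl_arr (\<one>\<^bsub>V\<^esub> K) v t \<longleftrightarrow> t \<in> hom S (cyl K X) (cyl K Y) \<and>
    far (enr S) (\<one>\<^bsub>S\<^esub> X, t) \<cdot>\<^bsub>V\<^esub> \<alpha> K X = far (enr S) (v, \<one>\<^bsub>S\<^esub> (cyl K Y)) \<cdot>\<^bsub>V\<^esub> \<alpha> K Y"
  using assms S.homD [OF assms(2)] by (simp add: is_cyl_arr_def)

lemma is_cylinder_bifunctor_cyl_functor: "is_cylinder_bifunctor V S cyl \<alpha> cyl_functor"
proof -
  have "is_cyl_arr u (\<one>\<^bsub>S\<^esub> X) (far cyl_functor (u, \<one>\<^bsub>S\<^esub> X))" if "u \<in> hom V K L" "X \<in> obj S" for u K L X
    using that V.homD by (intro is_cyl_arr_cyl_functor) auto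
  moreover have "is_cyl_arr (\<one>\<^bsub>V\<^esub> K) v (far cyl_functor (\<one>\<^bsub>V\<^esub> K, v))" if "v \<in> hom S X Y" "K \<in> obj V" for v K X Y
    using that S.homD by (intro is_cyl_arr_cyl_functor) auto
  moreover have "fob cyl_functor (K, X) = cyl K X" if "K \<in> obj V" "X \<in> obj S" for K X
    using that by (simp add: cyl_functor_def)
  ultimately show ?thesis
    unfolding is_cylinder_bifunctor_def
    by (auto simp: is_functor_cyl_functor is_cyl_arr_left is_cyl_arr_right)
qed

section \<open>Uniqueness of the bifunctor and naturality in \<open>K\<close> and
  \<open>X\<close>\<close>

context
  fixes T
  assumes T: "is_cylinder_bifunctor V S cyl \<alpha> T"
begin

interpretation T: is_functor "V \<times>\<^sub>c S" S T
  using T by (simp add: is_cylinder_bifunctor_def)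

lemma bifunctor_obj: "K \<in> obj V \<Longrightarrow> X \<in> obj S \<Longrightarrow> fob T (K, X) = cyl K X"
  using T by (simp add: is_cylinder_bifunctor_def)

lemma bifunctor_hom:
  assumes "u \<in> hom V K L" "v \<in> hom S X Y"
  shows "far T (u, v) \<in> hom S (cyl K X) (cyl L Y)"
  using T.far_hom [of "(u, v)" "(K, X)" "(L, Y)"] assms V.homD [OF assms(1)] S.homD [OF assms(2)]
  by (simp add: hom_def bifunctor_obj)

lemma bifunctor_is_cyl_arr_left:
  assumes "u \<in> hom V K L" "X \<in> obj S"
  shows "is_cyl_arr u (\<one>\<^bsub>S\<^esub> X) (far T (u, \<one>\<^bsub>S\<^esub> X))"
  using T assms V.homD [OF assms(1)] bifunctor_hom [OF assms(1) S.ide_hom [OF assms(2)]]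
  by (auto simp: is_cyl_arr_left is_cylinder_bifunctor_def)

lemma bifunctor_is_cyl_arr_right:
  assumes "K \<in> obj V" "v \<in> hom S X Y"
  shows "is_cyl_arr (\<one>\<^bsub>V\<^esub> K) v (far T (\<one>\<^bsub>V\<^esub> K, v))"
  using T assms S.homD [OF assms(2)] bifunctor_hom [OF V.ide_hom [OF assms(1)] assms(2)]
  by (auto simp: is_cyl_arr_right is_cylinder_bifunctor_def)

text \<open>The requirements on \<open>T\<close> concern one variable at a time, but by
  functoriality \<open>far T (u, v)\<close> is the action of \<open>u\<close> followed by that of
  \<open>v\<close>, and \<open>is_cyl_arr\<close> is stable under composition.\<close>

lemma bifunctor_is_cyl_arr:
  assumes [simp]: "u \<in> arr V" "v \<in> arr S"
  shows "is_cyl_arr u v (far T (u, v))"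
proof -
  let ?K = "src V u" and ?L = "tgt V u" and ?X = "src S v" and ?Y = "tgt S v"
  have "is_cyl_arr (\<one>\<^bsub>V\<^esub> ?L \<cdot>\<^bsub>V\<^esub> u) (v \<cdot>\<^bsub>S\<^esub> \<one>\<^bsub>S\<^esub> ?X) (far T (\<one>\<^bsub>V\<^esub> ?L, v) \<cdot>\<^bsub>S\<^esub> far T (u, \<one>\<^bsub>S\<^esub> ?X))"
    by (rule is_cyl_arr_cmp [OF _ _ _ _ _ _ bifunctor_is_cyl_arr_left bifunctor_is_cyl_arr_right])
      (auto intro!: V.homI S.homI)
  moreover have "far T (\<one>\<^bsub>V\<^esub> ?L, v) \<cdot>\<^bsub>S\<^esub> far T (u, \<one>\<^bsub>S\<^esub> ?X) = far T (u, v)"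
    by (subst T.far_cmp_arr) simp_all
  ultimately show ?thesis
    by simp
qed

text \<open>Both functors are extensional, so agreement on objects and arrows suffices; on arrows
  both values satisfy \<open>is_cyl_arr\<close>, which has only one solution.\<close>

lemma bifunctor_unique: "T = cyl_functor"
proof -
  interpret F: is_functor "V \<times>\<^sub>c S" S cyl_functor
    by (rule is_functor_cyl_functor)
  have "fob T = fob cyl_functor"
    by (rule extensionalityI [OF T.fob_ext F.fob_ext]) (auto simp: bifunctor_obj cyl_functor_def)
  moreover have "far T = far cyl_functor"
    by (rule extensionalityI [OF T.far_ext F.far_ext])
      (auto intro: is_cyl_arr_unique bifunctor_is_cyl_arr is_cyl_arr_cyl_functor)
  ultimately show ?thesis
    by simp
qed

lemma bifunctor_\<phi>_natural:
  assumes u: "u \<in> hom V K L" and v: "v \<in> hom S X X'" and Y: "Y \<in> obj S"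
  shows "far (ihom V) (u, far (enr S) (v, \<one>\<^bsub>S\<^esub> Y)) \<cdot>\<^bsub>V\<^esub> \<phi> L X' Y =
    \<phi> K X Y \<cdot>\<^bsub>V\<^esub> far (enr S) (far T (u, v), \<one>\<^bsub>S\<^esub> Y)"
  using bifunctor_is_cyl_arr [of u v] V.homD [OF u] S.homD [OF v]
  by (intro cylinder_transformation [OF cyl cyl u v _ Y]) (simp_all add: is_cyl_arr_def)

end

end

theorem proposition1p6:
  fixes V :: "('o, 'a) closed_monoidal_data"
    and S :: "('p, 'b, 'o, 'a) enriched_data"
    and cyl :: "'o \<Rightarrow> 'p \<Rightarrow> 'p"
    and \<alpha> :: "'o \<Rightarrow> 'p \<Rightarrow> 'a"
    and \<phi> :: "'o \<Rightarrow> 'p \<Rightarrow> 'p \<Rightarrow> 'a"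
  assumes "closed_monoidal_category V"
    and "category_with_structure V S"
    and "\<And>K X. K \<in> obj V \<Longrightarrow> X \<in> obj S \<Longrightarrow> is_cylinder V S K X (cyl K X) (\<alpha> K X) (\<phi> K X)"
  shows "(\<exists>!T. is_cylinder_bifunctor V S cyl \<alpha> T) \<and>
    (\<forall>T. is_cylinder_bifunctor V S cyl \<alpha> T \<longrightarrow>
      (\<forall>K\<in>obj V. \<forall>L\<in>obj V. \<forall>X\<in>obj S. \<forall>Y\<in>obj S. \<forall>u\<in>hom V K L.
        far (ihom V) (u, \<one>\<^bsub>V\<^esub> (fob (enr S) (X, Y))) \<cdot>\<^bsub>V\<^esub> \<phi> L X Y =
        \<phi> K X Y \<cdot>\<^bsub>V\<^esub> far (enr S) (far T (u, \<one>\<^bsub>S\<^esub> X), \<one>\<^bsub>S\<^esub> Y)) \<and>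
      (\<forall>K\<in>obj V. \<forall>X\<in>obj S. \<forall>X'\<in>obj S. \<forall>Y\<in>obj S. \<forall>v\<in>hom S X X'.
        far (ihom V) (\<one>\<^bsub>V\<^esub> K, far (enr S) (v, \<one>\<^bsub>S\<^esub> Y)) \<cdot>\<^bsub>V\<^esub> \<phi> K X' Y =
        \<phi> K X Y \<cdot>\<^bsub>V\<^esub> far (enr S) (far T (\<one>\<^bsub>V\<^esub> K, v), \<one>\<^bsub>S\<^esub> Y)) \<and>
      (\<forall>K\<in>obj V. \<forall>X\<in>obj S. \<forall>Y\<in>obj S. \<forall>Y'\<in>obj S. \<forall>w\<in>hom S Y Y'.
        far (ihom V) (\<one>\<^bsub>V\<^esub> K, far (enr S) (\<one>\<^bsub>S\<^esub> X, w)) \<cdot>\<^bsub>V\<^esub> \<phi> K X Y =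
        \<phi> K X Y' \<cdot>\<^bsub>V\<^esub> far (enr S) (\<one>\<^bsub>S\<^esub> (cyl K X), w)))"
proof -
  interpret cylinder_choice V S cyl \<alpha> \<phi>
    using assms by (auto intro!: cylinder_choice.intro simp: cylinder_choice_axioms_def)
  show ?thesis
  proof (intro conjI allI impI ballI)
    show "\<exists>!T. is_cylinder_bifunctor V S cyl \<alpha> T"
      using is_cylinder_bifunctor_cyl_functor bifunctor_unique by blast
  next
    fix T K L X Y u
    assume "is_cylinder_bifunctor V S cyl \<alpha> T" "X \<in> obj S" "Y \<in> obj S" "u \<in> hom V K L"
    \<comment> \<open>Joint naturality with the identity of \<open>X\<close> for \<open>v\<close>;
      \<open>enr_ide\<close> reduces its action on the hom-object to an identity.\<close>
    then show "far (ihom V) (u, \<one>\<^bsub>V\<^esub> (fob (enr S) (X, Y))) \<cdot>\<^bsub>V\<^esub> \<phi> L X Y =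
      \<phi> K X Y \<cdot>\<^bsub>V\<^esub> far (enr S) (far T (u, \<one>\<^bsub>S\<^esub> X), \<one>\<^bsub>S\<^esub> Y)"
      using bifunctor_\<phi>_natural [OF _ _ S.ide_hom] by (simp add: enr_ide)
  next
    fix T K X X' Y v
    assume "is_cylinder_bifunctor V S cyl \<alpha> T" "K \<in> obj V" "Y \<in> obj S" "v \<in> hom S X X'"
    then show "far (ihom V) (\<one>\<^bsub>V\<^esub> K, far (enr S) (v, \<one>\<^bsub>S\<^esub> Y)) \<cdot>\<^bsub>V\<^esub> \<phi> K X' Y =
      \<phi> K X Y \<cdot>\<^bsub>V\<^esub> far (enr S) (far T (\<one>\<^bsub>V\<^esub> K, v), \<one>\<^bsub>S\<^esub> Y)"
      using bifunctor_\<phi>_natural [OF _ V.ide_hom] by simp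
  next
    fix K X Y Y' w
    assume "K \<in> obj V" "X \<in> obj S" "w \<in> hom S Y Y'"
    then show "far (ihom V) (\<one>\<^bsub>V\<^esub> K, far (enr S) (\<one>\<^bsub>S\<^esub> X, w)) \<cdot>\<^bsub>V\<^esub> \<phi> K X Y =
      \<phi> K X Y' \<cdot>\<^bsub>V\<^esub> far (enr S) (\<one>\<^bsub>S\<^esub> (cyl K X), w)"
      by (rule cylinder.\<phi>_natural [OF cyl])
  qed
qed

end
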